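(* Let $I=[0,1)$ or $I=\mathbb{R}$. Let $n\ge 2$ and let $\Phi=\{\phi_1,\ldots,\phi_n\}$ be an IFS defined on $I$. Then there exists a full set $W_\Phi\subset I$ such that for every $(x_1,\ldots,x_{n-1})\in\Omega_{n-1}(I)\cap W_\Phi^{n-1}$, the $n$-interval PC $f_{\phi_1,\ldots,\phi_n,x_1,\ldots,x_{n-1}}:I\to I$ is asymptotically periodic and has at most $n$ periodic orbits.
   Context: Let $\overline{I}$ and $\mathring{I}$ be the closure and the interior of $I$ in $\mathbb{R}$. An Iterated Function System (IFS) defined on $I$ is an ordered list $\{\phi_1,\ldots,\phi_n\}$, $n\ge2$, of maps $\phi_i:\overline{I}\to\mathring{I}$, each of which is a Lipschitz contraction (Lipschitz with constant $<1$). With $\inf\mathbb{R}=-\infty$, $\sup\mathbb{R}=\infty$, set $\Omega_{n-1}(I)=\{(x_1,\ldots,x_{n-1}):\inf I<x_1<\cdots<x_{n-1}<\sup I\}$. For $(x_1,\ldots,x_{n-1})\in\Omega_{n-1}(I)$, the $n$-interval piecewise contraction (PC) $f_{\phi_1,\ldots,\phi_n,x_1,\ldots,x_{n-1}}:I\to I$ is the map equal to $\phi_1(x)$ if $x\in I\cap(-\infty,x_1)$, to $\phi_i(x)$ if $x\in[x_{i-1},x_i)$ with $2\le i\le n-1$, and to $\phi_n(x)$ if $x\in I\cap[x_{n-1},\infty)$. A subset $W\subset I$ is a full set if $\mu(I\setminus W)=0$, where $\mu$ is Lebesgue measure. For a map $f:I\to I$ and $x\in I$, $O_f(x)=\bigcup_{k\ge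 0}\{f^k(x)\}$ is called a periodic orbit if $f^k(x)=x$ for some $k\ge1$; $\omega_f(x)=\bigcap_{m\ge 0}\overline{\bigcup_{k\ge m}\{f^k(x)\}}$; and $f$ is asymptotically periodic if $\omega_f(x)$ is a periodic orbit of $f$ for every $x\in I$. *)

theory Defs
  imports "HOL-Analysis.Analysis"
begin

text \<open>An ordered list \<open>\<phi>\<^sub>1, \<dots>, \<phi>\<^sub>n\<close> is a function on indices, of which only the values on
  \<open>{1..n}\<close> matter. A map \<open>closure I \<rightarrow> interior I\<close> is a total function
  \<open>real \<Rightarrow> real\<close>, of which only the values on \<open>closure I\<close> matter.\<close>

definition is_IFS :: "real set \<Rightarrow> nat \<Rightarrow> (nat \<Rightarrow> real \<Rightarrow> real) \<Rightarrow> bool" where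
  "is_IFS I n \<phi> \<longleftrightarrow> n \<ge> 2 \<and>
     (\<forall>i\<in>{1..n}. \<phi> i \<in> closure I \<rightarrow> interior I \<and> (\<exists>L<1. L-lipschitz_on (closure I) (\<phi> i)))"

text \<open>\<open>\<Omega>\<^sub>m(I)\<close>: real \<open>m\<close>-tuples are extensional functions on \<open>{1..m}\<close>. Infimum and supremum are
  taken in the extended reals, so that they are \<open>-\<infinity>\<close> and \<open>\<infinity>\<close> for \<open>I = \<real>\<close>.\<close>

definition Omega :: "nat \<Rightarrow> real set \<Rightarrow> (nat \<Rightarrow> real) set" where
  "Omega m I = {x \<in> {1..m} \<rightarrow>\<^sub>E UNIV. (INF t\<in>I. ereal t) < ereal (x 1) \<and>
     strict_mono_on {1..m} x \<and> ereal (x m) < (SUP t\<in>I. ereal t)}"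

text \<open>The piecewise contraction \<open>f\<close> with parameters \<open>\<phi>\<^sub>1, \<dots>, \<phi>\<^sub>n, x\<^sub>1, \<dots>, x\<^bsub>n-1\<^esub>\<close>, meant
  for arguments in \<open>I\<close>.
  The index in the last case exists and is unique when \<open>x\<close> is strictly increasing.\<close>

definition pc :: "nat \<Rightarrow> (nat \<Rightarrow> real \<Rightarrow> real) \<Rightarrow> (nat \<Rightarrow> real) \<Rightarrow> real \<Rightarrow> real" where
  "pc n \<phi> x t =
     (if t < x 1 then \<phi> 1 t
      else if x (n - 1) \<le> t then \<phi> n t
      else \<phi> (THE i. i \<in> {2..n - 1} \<and> t \<in> {x (i - 1)..<x i}) t)"

definition full_set :: "real set \<Rightarrow> real set \<Rightarrow> bool" where
  "full_set I W \<longleftrightarrow> W \<subseteq> I \<and> I - W \<in> null_sets lebesgue"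

definition orbit :: "(real \<Rightarrow> real) \<Rightarrow> real \<Rightarrow> real set" where
  "orbit f t = (\<Union>k. {(f ^^ k) t})"

definition periodic_orbits :: "real set \<Rightarrow> (real \<Rightarrow> real) \<Rightarrow> real set set" where
  "periodic_orbits I f = {orbit f t |t. t \<in> I \<and> (\<exists>k\<ge>1. (f ^^ k) t = t)}"

definition omega_limit :: "(real \<Rightarrow> real) \<Rightarrow> real \<Rightarrow> real set" where
  "omega_limit f t = (\<Inter>m. closure (\<Union>k\<in>{m..}. {(f ^^ k) t}))"

definition asymptotically_periodic :: "real set \<Rightarrow> (real \<Rightarrow> real) \<Rightarrow> bool" where
  "asymptotically_periodic I f \<longleftrightarrow> (\<forall>t\<in>I. omega_limit f t \<in> periodic_orbits I f)"

lemma pc_index_unique: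
  fixes n :: nat and x :: "nat \<Rightarrow> real"
  assumes x: "strict_mono_on {1..n - 1} x" and t: "x 1 \<le> t" "t < x (n - 1)" and n: "n \<ge> 2"
  shows "\<exists>!i. i \<in> {2..n - 1} \<and> t \<in> {x (i - 1)..<x i}"
proof -
  define i where "i = (LEAST i. 1 \<le> i \<and> t < x i)"
  have ex: "1 \<le> n - 1 \<and> t < x (n - 1)" using t n by simp
  have i: "1 \<le> i \<and> t < x i" unfolding i_def by (rule LeastI[of _ "n - 1"]) (rule ex)
  have le: "i \<le> n - 1" unfolding i_def by (rule Least_le) (rule ex)
  have "i \<noteq> 1" using i t by auto
  with i have i2: "2 \<le> i" by simp
  have "\<not> (1 \<le> i - 1 \<and> t < x (i - 1))"
    using not_less_Least[of "i - 1" "\<lambda>i. 1 \<le> i \<and> t < x i"] i2 unfolding i_def[symmetric] by simp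
  moreover have "1 \<le> i - 1" using i2 by arith
  ultimately have "x (i - 1) \<le> t" by (meson not_less)
  with i i2 le have P: "i \<in> {2..n - 1} \<and> t \<in> {x (i - 1)..<x i}" by simp
  have less: "\<not> j < k" if "j \<in> {2..n - 1}" "k \<in> {2..n - 1}" "t < x j" "x (k - 1) \<le> t" for j k
  proof
    assume "j < k"
    with that have "j \<in> {1..n - 1}" "k - 1 \<in> {1..n - 1}" "j \<le> k - 1"
      unfolding atLeastAtMost_iff by linarith+
    then have "x j \<le> x (k - 1)"
      by (rule strict_mono_on_leD[OF x])
    with that show False by linarith
  qed
  show ?thesis
  proof (rule ex1I[of _ i])
    fix j assume j: "j \<in> {2..n - 1} \<and> t \<in> {x (j - 1)..<x j}"
    then show "j = i" using P less[of i j] less[of j i] by auto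
  qed (rule P)
qed

lemma pc_maps_to:
  assumes "is_IFS I n \<phi>" "x \<in> Omega (n - 1) I"
  shows "pc n \<phi> x \<in> I \<rightarrow> I"
proof
  fix t assume "t \<in> I"
  have \<phi>: "\<phi> i t \<in> I" if "i \<in> {1..n}" for i
  proof -
    have "\<phi> i \<in> closure I \<rightarrow> interior I" using assms(1) that by (simp add: is_IFS_def)
    then show ?thesis using \<open>t \<in> I\<close> closure_subset[of I] interior_subset[of I] by blast
  qed
  have n: "n \<ge> 2" using assms(1) by (simp add: is_IFS_def)
  show "pc n \<phi> x t \<in> I"
  proof (cases "x 1 \<le> t \<and> t < x (n - 1)")
    case True
    have "strict_mono_on {1..n - 1} x" using assms(2) by (simp add: Omega_def)
    from theI'[OF pc_index_unique[OF this _ _ n]] True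
    have "(THE i. i \<in> {2..n - 1} \<and> t \<in> {x (i - 1)..<x i}) \<in> {2..n - 1}" by blast
    with True \<phi> show ?thesis by (auto simp: pc_def)
  next
    case False
    with \<phi> n show ?thesis by (auto simp: pc_def)
  qed
qed

end

theory Submission
  imports Defs
begin

text \<open>
  Let \<open>f\<close> be the piecewise contraction, let \<open>\<lambda> < 1\<close> be a common Lipschitz constant of the maps
  \<open>\<phi>\<^sub>i\<close>, and let \<open>C\<close> be a compact interval that every map \<open>\<phi>\<^sub>i\<close> preserves and that every orbit
  enters. If some compact \<open>D\<close> with \<open>f(D) \<subseteq> D\<close> contains \<open>f\<^sup>J(C)\<close> for some \<open>J\<close> but contains no
  breakpoint, then \<open>f\<close> contracts any two points of \<open>D\<close> that are close enough to each other, because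
  no breakpoint separates them. A recurrence of an orbit in \<open>D\<close> then forces the orbit to converge to
  a cycle (\<open>omega_limit_periodic_orbit\<close>). So generic breakpoints have to be shown to miss such a \<open>D\<close>.

  For fixed breakpoints the sets \<open>f\<^sup>j(C)\<close> have measure at most \<open>\<lambda>\<^sup>j |C|\<close>, so the set that the
  breakpoints have to avoid is null. But this set depends on the breakpoints, whereas the null set to
  be removed may depend on the maps \<open>\<phi>\<^sub>i\<close> only. The remedy is to blur the breakpoints: \<open>x\<^sub>i\<close> is only
  known to lie in a box \<open>[a\<^sub>i, b\<^sub>i]\<close> with rational endpoints, and on that box both \<open>\<phi>\<^sub>i\<close> and
  \<open>\<phi>\<^bsub>i+1\<^esub>\<close> are applied. Each visit to a box doubles the number of branches, which could destroy the
  contraction of measure. However, outside a countable set, no \<open>x\<^sub>i\<close> is fixed by a composition of the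
  maps. Given \<open>k\<close>, the boxes around such breakpoints can then be chosen so small that no orbit returns
  to a box within \<open>k\<close> steps. Within \<open>k\<close> steps an orbit therefore branches at most once in each of the
  \<open>n - 1\<close> boxes, and the \<open>k\<close>-th iterate of the blurred map multiplies outer measure by at most
  \<open>\<lambda>\<^sup>k 2\<^bsup>n-1\<^esup>\<close> (\<open>outer_funpow_fuzzy_image_le\<close>). This is at most \<open>1/2\<close> for large \<open>k\<close>, so the
  intersection of the iterates of \<open>C\<close> under the blurred map is null (\<open>attractor_null\<close>). There are only
  countably many tuples of rational boxes; removing the null sets among these intersections, together
  with the countable set of fixed points, leaves the required full set (\<open>generic_pc_on_line\<close>).

  The bound on the number of periodic orbits comes from a connected graph. Its vertices are the
  periodic orbits, and each of the \<open>n - 1\<close> breakpoints is an edge that joins the orbits of the nearest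
  periodic points to its left and to its right. If the orbits are split into two classes, then a
  closest pair of points from different classes is separated by a breakpoint, as otherwise \<open>f\<close> would
  bring the two points closer together. So every split is crossed by an edge, the graph is connected,
  and it has at most \<open>n\<close> vertices (\<open>card_periodic_orbits_le\<close>).

  The interval is reduced to the line by precomposing each \<open>\<phi>\<^sub>i\<close> with the retraction of the line onto
  the closed interval.
\<close>

section \<open>Outer Lebesgue measure on the line\<close>

text \<open>If some \<open>A k\<close> is not contained in the space of \<open>M\<close>, then its outer measure is an infimum over the
  empty set, hence infinite, and the inequality is trivial.\<close>

lemma outer_measure_of_UN_le_suminf:
  "outer_measure_of M (\<Union>k::nat. A k) \<le> (\<Sum>k. outer_measure_of M (A k))"
proof (cases "\<forall>k. A k \<subseteq> space M")
  case True
  then have "\<exists>E. E \<in> sets M \<and> A k \<subseteq> E \<and> outer_measure_of M (A k) = emeasure M E" for k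
    using outer_measure_of_attain[of "A k" M] by auto
  then obtain E where E: "\<And>k. E k \<in> sets M" "\<And>k. A k \<subseteq> E k"
    "\<And>k. outer_measure_of M (A k) = emeasure M (E k)" by metis
  have "outer_measure_of M (\<Union>k. A k) \<le> outer_measure_of M (\<Union>k. E k)"
    by (intro outer_measure_of_mono) (use E in blast)
  also have "\<dots> = emeasure M (\<Union>k. E k)" using E by (intro outer_measure_of_eq) auto
  also have "\<dots> \<le> (\<Sum>k. emeasure M (E k))" using E by (intro emeasure_subadditive_countably) auto
  finally show ?thesis using E by simp
next
  case False
  then obtain k where "\<not> A k \<subseteq> space M" by blast
  then have "{B \<in> sets M. A k \<subseteq> B} = {}" using sets.sets_into_space by blast
  then have "outer_measure_of M (A k) = top" by (simp only: outer_measure_of_def) simp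
  moreover have "outer_measure_of M (A k) \<le> (\<Sum>k. outer_measure_of M (A k))"
    using sum_le_suminf[of "\<lambda>k. outer_measure_of M (A k)" "{k}"] by simp
  ultimately show ?thesis by (simp add: top_unique)
qed

lemma outer_measure_of_Un_le:
  "outer_measure_of M (A \<union> B) \<le> outer_measure_of M A + outer_measure_of M B"
proof -
  let ?X = "\<lambda>k::nat. if k = 0 then A else if k = 1 then B else {}"
  have "A \<union> B = (\<Union>k. ?X k)" by (auto split: if_splits)
  then have "outer_measure_of M (A \<union> B) \<le> (\<Sum>k. outer_measure_of M (?X k))"
    by (metis outer_measure_of_UN_le_suminf)
  also have "\<dots> = (\<Sum>k\<in>{0,1}. outer_measure_of M (?X k))"
    by (rule suminf_finite) auto
  finally show ?thesis by simp
qed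

lemma outer_measure_of_UN_le_sum:
  "finite K \<Longrightarrow> outer_measure_of M (\<Union>k\<in>K. A k) \<le> (\<Sum>k\<in>K. outer_measure_of M (A k))"
proof (induction K rule: finite_induct)
  case (insert x F)
  have "outer_measure_of M (\<Union>k\<in>insert x F. A k) \<le> outer_measure_of M (A x) + outer_measure_of M (\<Union>k\<in>F. A k)"
    using outer_measure_of_Un_le by simp
  also have "\<dots> \<le> outer_measure_of M (A x) + (\<Sum>k\<in>F. outer_measure_of M (A k))"
    using insert by (intro add_left_mono)
  finally show ?case using insert by simp
qed simp

text \<open>Working with outer measure makes it possible to take images without proving them measurable. It is
  still additive along a measurable partition: one inequality is subadditivity, and the other one,
  which is needed to split a set into pieces at no cost, is read off a measurable hull.\<close>

lemma sum_outer_measure_of_Int_le: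
  assumes "A \<subseteq> space M" "finite K" "\<And>k. k \<in> K \<Longrightarrow> T k \<in> sets M" "disjoint_family_on T K"
  shows "(\<Sum>k\<in>K. outer_measure_of M (A \<inter> T k)) \<le> outer_measure_of M A"
proof -
  obtain E where E: "E \<in> sets M" "A \<subseteq> E" "outer_measure_of M A = emeasure M E"
    using outer_measure_of_attain[OF assms(1)] by blast
  have "outer_measure_of M (A \<inter> T k) \<le> emeasure M (E \<inter> T k)" if "k \<in> K" for k
    using outer_measure_of_mono[of "A \<inter> T k" "E \<inter> T k" M] E assms(3)[OF that] by auto
  then have "(\<Sum>k\<in>K. outer_measure_of M (A \<inter> T k)) \<le> (\<Sum>k\<in>K. emeasure M (E \<inter> T k))"
    by (rule sum_mono)
  also have "\<dots> = emeasure M (\<Union>k\<in>K. E \<inter> T k)"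
    using E assms by (intro sum_emeasure disjoint_family_on_bisimulation[OF assms(4)]) auto
  also have "\<dots> \<le> emeasure M E" using E by (intro emeasure_mono) auto
  finally show ?thesis using E by simp
qed

lemma outer_lborel_zero_null:
  assumes "outer_measure_of lborel N = 0"
  shows "N \<in> null_sets lebesgue"
proof -
  obtain E where "E \<in> sets lborel" "N \<subseteq> E" "emeasure lborel E = 0"
    using outer_measure_of_attain[of N lborel] assms by auto
  then show ?thesis by (meson null_setsI null_sets_completionI null_sets_completion_subset)
qed

lemma outer_lborel_le_diameter:
  fixes S :: "real set"
  assumes "\<And>s t. s \<in> S \<Longrightarrow> t \<in> S \<Longrightarrow> \<bar>s - t\<bar> \<le> d"
  shows "outer_measure_of lborel S \<le> ennreal d"
proof (cases "S = {}")
  case False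
  then obtain s0 where s0: "s0 \<in> S" by blast
  have d: "0 \<le> d" using assms[OF s0 s0] by simp
  have bdd: "bdd_below S"
    using assms[OF s0] by (intro bdd_belowI[of _ "s0 - d"]) (smt (verit))
  have "S \<subseteq> {Inf S..Inf S + d}"
  proof
    fix t assume t: "t \<in> S"
    have "t - d \<le> Inf S"
      using assms[OF t] False by (intro cInf_greatest) (smt (verit))+
    then show "t \<in> {Inf S..Inf S + d}" using cInf_lower[OF t bdd] by simp
  qed
  then have "outer_measure_of lborel S \<le> outer_measure_of lborel {Inf S..Inf S + d}"
    by (rule outer_measure_of_mono)
  also have "\<dots> = ennreal d" using d by simp
  finally show ?thesis .
qed simp

text \<open>For an open set, each component is an interval whose length bounds the diameter of its image. Outer
  regularity passes from open sets to all sets.\<close>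

lemma outer_lborel_lipschitz_image_le:
  fixes f :: "real \<Rightarrow> real"
  assumes L: "L-lipschitz_on UNIV f"
  shows "outer_measure_of lborel (f ` A) \<le> ennreal L * outer_measure_of lborel A"
proof -
  have L0: "0 \<le> L" using L by (rule lipschitz_on_nonneg)
  have open_case: "outer_measure_of lborel (f ` V) \<le> ennreal L * emeasure lborel V"
    if V: "open V" for V
  proof -
    let ?C = "components V"
    (* The components enumerated by all natural numbers, with empty sets in the unused places. *)
    define X where "X k = (if k \<in> to_nat_on ?C ` ?C then from_nat_into ?C k else {})" for k
    have cC: "countable ?C" 
      using open_components[OF V] pairwise_disjoint_components[of V]
      by (intro countable_disjoint_open_subsets) (auto simp: disjoint_def pairwise_def disjnt_def)
    have XC: "X k \<in> ?C \<or> X k = {}" for k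
      unfolding X_def using cC by auto
    have UX: "(\<Union>k. X k) = V"
    proof
      show "(\<Union>k. X k) \<subseteq> V" using XC in_components_subset by blast
      show "V \<subseteq> (\<Union>k. X k)"
      proof
        fix v assume "v \<in> V"
        then obtain c where c: "c \<in> ?C" "v \<in> c" by (metis Union_components UnionE)
        then have "X (to_nat_on ?C c) = c" using cC by (simp add: X_def)
        with c show "v \<in> (\<Union>k. X k)" by blast
      qed
    qed
    have dX: "disjoint_family X"
    proof (unfold disjoint_family_on_def, intro ballI impI)
      fix j k :: nat assume "j \<noteq> k"
      show "X j \<inter> X k = {}"
      proof (cases "j \<in> to_nat_on ?C ` ?C \<and> k \<in> to_nat_on ?C ` ?C")
        case True
        then obtain c d where "c \<in> ?C" "d \<in> ?C" "j = to_nat_on ?C c" "k = to_nat_on ?C d" by blast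
        with \<open>j \<noteq> k\<close> have "X j = c" "X k = d" "c \<noteq> d" using cC by (auto simp: X_def)
        then show ?thesis using \<open>c \<in> ?C\<close> \<open>d \<in> ?C\<close> by (metis components_nonoverlap)
      qed (auto simp: X_def)
    qed
    have oX: "open (X k)" for k using XC[of k] open_components[OF V] by auto
    have le: "outer_measure_of lborel (f ` X k) \<le> ennreal L * emeasure lborel (X k)" for k
    proof (cases "emeasure lborel (X k) = \<infinity>")
      case True
      show ?thesis
      proof (cases "L = 0")
        case True
        then have "\<bar>f s - f t\<bar> \<le> 0" for s t
          using lipschitz_onD[OF L, of s t] by (simp add: dist_real_def)
        then show ?thesis using outer_lborel_le_diameter[of "f ` X k" 0] True by auto
      next
        case False
        then show ?thesis using L0 True by (simp add: ennreal_mult_top)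
      qed
    next
      case False
      define m where "m = measure lborel (X k)"
      have m: "emeasure lborel (X k) = ennreal m"
        unfolding m_def using False by (simp add: emeasure_eq_ennreal_measure)
      have con: "connected (X k)" using XC[of k] in_components_connected by auto
      have len: "t - s \<le> m" if "s \<in> X k" "t \<in> X k" "s \<le> t" for s t
      proof -
        have "{s..t} \<subseteq> X k" using connected_contains_Icc[OF con] that by blast
        then have "emeasure lborel {s..t} \<le> emeasure lborel (X k)"
          using oX by (intro emeasure_mono) auto
        then show ?thesis using that m by (simp add: m_def)
      qed
      have "\<bar>f s - f t\<bar> \<le> L * m" if "s \<in> X k" "t \<in> X k" for s t
      proof -
        have "\<bar>f s - f t\<bar> \<le> L * \<bar>s - t\<bar>"
          using lipschitz_onD[OF L, of s t] by (simp add: dist_real_def)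
        also have "\<dots> \<le> L * m" using len[of s t] len[of t s] that L0
          by (intro mult_left_mono) (auto simp: abs_if)
        finally show ?thesis .
      qed
      then have "outer_measure_of lborel (f ` X k) \<le> ennreal (L * m)"
        by (intro outer_lborel_le_diameter) auto
      then show ?thesis using m L0 by (simp add: ennreal_mult m_def)
    qed
    have "outer_measure_of lborel (f ` V) = outer_measure_of lborel (\<Union>k. f ` X k)"
      using UX by (metis image_UN)
    also have "\<dots> \<le> (\<Sum>k. outer_measure_of lborel (f ` X k))" by (rule outer_measure_of_UN_le_suminf)
    also have "\<dots> \<le> (\<Sum>k. ennreal L * emeasure lborel (X k))" using le by (intro suminf_le) auto
    also have "\<dots> = ennreal L * (\<Sum>k. emeasure lborel (X k))" by simp
    also have "(\<Sum>k. emeasure lborel (X k)) = emeasure lborel V"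
      using suminf_emeasure[OF _ dX, of lborel] oX UX by (auto simp: image_subset_iff)
    finally show ?thesis .
  qed
  obtain B where B: "B \<in> sets lborel" "A \<subseteq> B" "outer_measure_of lborel A = emeasure lborel B"
    using outer_measure_of_attain[of A lborel] by auto
  show ?thesis
  proof (cases "emeasure lborel B = \<infinity> \<and> L \<noteq> 0")
    case True
    then show ?thesis using B L0 by (simp add: ennreal_mult_top)
  next
    case False
    have eps: "outer_measure_of lborel (f ` A) \<le> ennreal L * emeasure lborel B + ennreal e" if e: "0 < e" for e
    proof -
      have "0 < e / (L + 1)" using e L0 by simp
      then obtain U where U: "open U" "B \<subseteq> U" "emeasure lborel (U - B) < ennreal (e / (L + 1))"
        using outer_regular_lborel[of B "e / (L + 1)"] B by auto
      have "emeasure lborel U \<le> emeasure lborel B + emeasure lborel (U - B)"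
        using U B emeasure_subadditive[of B lborel "U - B"] by (simp add: Un_absorb1)
      also have "\<dots> \<le> emeasure lborel B + ennreal (e / (L + 1))"
        using U by (intro add_left_mono) simp
      finally have "ennreal L * emeasure lborel U \<le> ennreal L * emeasure lborel B + ennreal L * ennreal (e / (L + 1))"
        by (metis distrib_left mult_left_mono zero_le)
      also have "ennreal L * ennreal (e / (L + 1)) \<le> ennreal e"
      proof -
        have "L * (e / (L + 1)) \<le> e" using L0 e by (simp add: field_simps)
        then show ?thesis using L0 e by (simp add: ennreal_mult[symmetric] ennreal_leI)
      qed
      finally have *: "ennreal L * emeasure lborel U \<le> ennreal L * emeasure lborel B + ennreal e"
        by (simp add: add_left_mono)
      have "outer_measure_of lborel (f ` A) \<le> outer_measure_of lborel (f ` U)"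
        using B U by (intro outer_measure_of_mono) auto
      also have "\<dots> \<le> ennreal L * emeasure lborel U" by (rule open_case[OF U(1)])
      finally show ?thesis using * by order
    qed
    have "outer_measure_of lborel (f ` A) \<le> ennreal L * emeasure lborel B"
      by (rule ennreal_le_epsilon) (rule eps)
    then show ?thesis using B by simp
  qed
qed

section \<open>Iterating with blurred breakpoints\<close>

text \<open>The points to which \<open>\<phi> i\<close> can be applied when each breakpoint \<open>x j\<close> is only known to lie in
  \<open>[a j, b j]\<close>. The intervals are closed so that images of compact sets stay compact.\<close>

definition fuzzy_piece :: "nat \<Rightarrow> (nat \<Rightarrow> real) \<Rightarrow> (nat \<Rightarrow> real) \<Rightarrow> nat \<Rightarrow> real set" where
  "fuzzy_piece n a b i = {t. (i = 1 \<or> a (i - 1) \<le> t) \<and> (i = n \<or> t \<le> b i)}"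

definition fuzzy_image ::
  "nat \<Rightarrow> (nat \<Rightarrow> real \<Rightarrow> real) \<Rightarrow> (nat \<Rightarrow> real) \<Rightarrow> (nat \<Rightarrow> real) \<Rightarrow> real set \<Rightarrow> real set" where
  "fuzzy_image n \<phi> a b A = (\<Union>i\<in>{1..n}. \<phi> i ` (A \<inter> fuzzy_piece n a b i))"

text \<open>The word \<open>ws\<close> stands for the composition of the maps \<open>\<phi> i\<close> with \<open>i\<close> running through \<open>ws\<close>, the
  last letter being applied first.\<close>

definition no_return :: "nat \<Rightarrow> (nat \<Rightarrow> real \<Rightarrow> real) \<Rightarrow> nat \<Rightarrow> real set \<Rightarrow> bool" where
  "no_return n \<phi> k S \<longleftrightarrow>
     (\<forall>ws t. ws \<noteq> [] \<longrightarrow> length ws \<le> k \<longrightarrow> set ws \<subseteq> {1..n} \<longrightarrow> t \<in> S \<longrightarrow> foldr \<phi> ws t \<notin> S)"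

lemma fuzzy_image_mono: "A \<subseteq> B \<Longrightarrow> fuzzy_image n \<phi> a b A \<subseteq> fuzzy_image n \<phi> a b B"
  unfolding fuzzy_image_def by blast

lemma funpow_fuzzy_image_mono:
  "A \<subseteq> B \<Longrightarrow> (fuzzy_image n \<phi> a b ^^ j) A \<subseteq> (fuzzy_image n \<phi> a b ^^ j) B"
  by (induction j) (auto intro!: fuzzy_image_mono)

lemma fuzzy_image_UN: "fuzzy_image n \<phi> a b (\<Union>k\<in>K. A k) = (\<Union>k\<in>K. fuzzy_image n \<phi> a b (A k))"
  unfolding fuzzy_image_def by blast

lemma funpow_fuzzy_image_UN:
  "(fuzzy_image n \<phi> a b ^^ j) (\<Union>k\<in>K. A k) = (\<Union>k\<in>K. (fuzzy_image n \<phi> a b ^^ j) (A k))"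
  by (induction j) (auto simp: fuzzy_image_UN)

lemma funpow_fuzzy_image_Un:
  "(fuzzy_image n \<phi> a b ^^ j) (A \<union> B) = (fuzzy_image n \<phi> a b ^^ j) A \<union> (fuzzy_image n \<phi> a b ^^ j) B"
  using funpow_fuzzy_image_UN[of j n \<phi> a b "\<lambda>X. X" "{A, B}"] by simp

lemma funpow_fuzzy_image_empty: "(fuzzy_image n \<phi> a b ^^ j) {} = {}"
  using funpow_fuzzy_image_UN[of j n \<phi> a b "\<lambda>X. X" "{}"] by simp

lemma funpow_fuzzy_image_word:
  "y \<in> (fuzzy_image n \<phi> a b ^^ l) A \<Longrightarrow>
     \<exists>ws t. t \<in> A \<and> length ws = l \<and> set ws \<subseteq> {1..n} \<and> y = foldr \<phi> ws t"
proof (induction l arbitrary: y)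
  case 0
  then show ?case by (intro exI[of _ "[]"]) auto
next
  case (Suc l)
  then obtain i z where i: "i \<in> {1..n}" "z \<in> (fuzzy_image n \<phi> a b ^^ l) A" "y = \<phi> i z"
    unfolding fuzzy_image_def by auto
  from Suc.IH[OF i(2)] obtain ws t where
    "t \<in> A" "length ws = l" "set ws \<subseteq> {1..n}" "z = foldr \<phi> ws t" by blast
  then show ?case using i by (intro exI[of _ "i # ws"] exI[of _ t]) auto
qed

lemma compact_fuzzy_image:
  assumes lip: "\<And>i. i \<in> {1..n} \<Longrightarrow> lam-lipschitz_on UNIV (\<phi> i)" and A: "compact A"
  shows "compact (fuzzy_image n \<phi> a b A)"
  unfolding fuzzy_image_def
proof (intro compact_UN finite_atLeastAtMost compact_continuous_image)
  fix i assume i: "i \<in> {1..n}"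
  show "continuous_on (A \<inter> fuzzy_piece n a b i) (\<phi> i)"
    using lipschitz_on_continuous_on[OF lip[OF i]] continuous_on_subset by blast
  have "fuzzy_piece n a b i = (if i = 1 then UNIV else {a (i - 1)..}) \<inter> (if i = n then UNIV else {..b i})"
    unfolding fuzzy_piece_def by auto
  then have "closed (fuzzy_piece n a b i)" by auto
  then show "compact (A \<inter> fuzzy_piece n a b i)" using A by (intro compact_Int_closed)
qed

text \<open>A point outside all boxes has one image, a point in a box has two. The set \<open>Z\<close>
  collects the boxes that can no longer be visited in the remaining \<open>j\<close> steps: by the
  condition \<open>no_return\<close>, a branch that leaves a box \<open>i\<close> avoids it from then
  on, so \<open>i\<close> joins \<open>Z\<close>. This halves the bound for each of the two branches and
  so makes up for the doubling. The line is cut into the boxes and the gaps between them, and the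
  contributions of these pieces add up because outer measure is additive along this partition.\<close>

lemma outer_funpow_fuzzy_image_le:
  assumes n: "n \<ge> 2"
    and lip: "\<And>i. i \<in> {1..n} \<Longrightarrow> lam-lipschitz_on UNIV (\<phi> i)"
    and ab: "\<And>i. i \<in> {1..n - 1} \<Longrightarrow> a i \<le> b i"
    and ba: "\<And>i j. i \<in> {1..n - 1} \<Longrightarrow> j \<in> {1..n - 1} \<Longrightarrow> i < j \<Longrightarrow> b i < a j"
    and nr: "\<And>i. i \<in> {1..n - 1} \<Longrightarrow> no_return n \<phi> k {a i..b i}"
    and Z: "Z \<subseteq> {1..n - 1}"
    and avoid: "\<And>l i. l < j \<Longrightarrow> i \<in> Z \<Longrightarrow> (fuzzy_image n \<phi> a b ^^ l) A \<inter> {a i..b i} = {}"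
    and j: "j \<le> k"
  shows "outer_measure_of lborel ((fuzzy_image n \<phi> a b ^^ j) A)
    \<le> ennreal (lam ^ j * 2 ^ (n - 1 - card Z)) * outer_measure_of lborel A"
  using Z avoid j
proof (induction j arbitrary: A Z)
  case 0
  have "outer_measure_of lborel A = ennreal 1 * outer_measure_of lborel A" by simp
  also have "\<dots> \<le> ennreal (2 ^ (n - 1 - card Z)) * outer_measure_of lborel A"
    by (intro mult_right_mono ennreal_leI) auto
  finally show ?case by simp
next
  case (Suc j)
  let ?F = "fuzzy_image n \<phi> a b"
  let ?mu = "outer_measure_of lborel"
  define T where "T i = {t. (i = 1 \<or> b (i - 1) < t) \<and> (i = n \<or> t < a i)}" for i
  define B where "B i = {a i..b i}" for i
  define C where "C = ennreal (lam ^ Suc j * 2 ^ (n - 1 - card Z))"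
  have lam: "0 \<le> lam" using lipschitz_on_nonneg[OF lip[of 1]] n by simp
  have bmono: "b i \<le> b i'" if "i \<in> {1..n - 1}" "i' \<in> {1..n - 1}" "i \<le> i'" for i i'
    using that ba[of i i'] ab[of i'] by (cases "i = i'") auto
  have amono: "a i \<le> a i'" if "i \<in> {1..n - 1}" "i' \<in> {1..n - 1}" "i \<le> i'" for i i'
    using that ba[of i i'] ab[of i] by (cases "i = i'") auto
  have TJ: "T i \<subseteq> fuzzy_piece n a b i" if "i \<in> {1..n}" for i
  proof
    fix t assume t: "t \<in> T i"
    have "a (i - 1) \<le> b (i - 1)" if "i \<noteq> 1"
      using \<open>i \<in> {1..n}\<close> that by (intro ab) auto
    moreover have "a i \<le> b i" if "i \<noteq> n"
      using \<open>i \<in> {1..n}\<close> that by (intro ab) auto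
    ultimately show "t \<in> fuzzy_piece n a b i"
      using t unfolding T_def fuzzy_piece_def by force
  qed
  have BJ: "B i \<subseteq> fuzzy_piece n a b i \<inter> fuzzy_piece n a b (Suc i)" if "i \<in> {1..n - 1}" for i
  proof
    fix t assume t: "t \<in> B i"
    have "a (i - 1) \<le> a i" if "i \<noteq> 1"
      using \<open>i \<in> {1..n - 1}\<close> that by (intro amono) auto
    moreover have "b i \<le> b (Suc i)" if "Suc i \<noteq> n"
      using \<open>i \<in> {1..n - 1}\<close> that by (intro bmono) auto
    ultimately show "t \<in> fuzzy_piece n a b i \<inter> fuzzy_piece n a b (Suc i)"
      using t by (force simp: B_def fuzzy_piece_def)
  qed
  have cover: "?F A \<subseteq> (\<Union>i\<in>{1..n}. \<phi> i ` (A \<inter> T i)) \<union>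
     (\<Union>i\<in>{1..n - 1}. \<phi> i ` (A \<inter> B i) \<union> \<phi> (Suc i) ` (A \<inter> B i))" (is "_ \<subseteq> ?P \<union> ?Q")
  proof
    fix y assume "y \<in> ?F A"
    then obtain i t where i: "i \<in> {1..n}" and t: "t \<in> A" "t \<in> fuzzy_piece n a b i" "y = \<phi> i t"
      unfolding fuzzy_image_def by blast
    consider "t \<in> T i" | "i \<noteq> 1" "t \<in> B (i - 1)" | "i \<noteq> n" "t \<in> B i"
      using t(2) unfolding T_def B_def fuzzy_piece_def by fastforce
    then show "y \<in> ?P \<union> ?Q"
    proof cases
      case 1
      then show ?thesis using i t by blast
    next
      case 2
      then have "i - 1 \<in> {1..n - 1}" "\<phi> (Suc (i - 1)) t = y" "t \<in> A \<inter> B (i - 1)"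
        using i t by auto
      then have "y \<in> ?Q" by blast
      then show ?thesis by blast
    next
      case 3
      then have "i \<in> {1..n - 1}" using i by auto
      then show ?thesis using 3 t by blast
    qed
  qed
  have pure: "?mu ((?F ^^ j) (\<phi> i ` (A \<inter> T i))) \<le> C * ?mu (A \<inter> T i)" if i: "i \<in> {1..n}" for i
  proof -
    have sub: "\<phi> i ` (A \<inter> T i) \<subseteq> ?F A"
      unfolding fuzzy_image_def using TJ[OF i] i by blast
    have "(?F ^^ l) (\<phi> i ` (A \<inter> T i)) \<inter> {a i'..b i'} = {}" if "l < j" "i' \<in> Z" for l i'
    proof -
      have "(?F ^^ l) (\<phi> i ` (A \<inter> T i)) \<subseteq> (?F ^^ Suc l) A"
        using funpow_fuzzy_image_mono[OF sub] by (simp add: funpow_swap1)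
      then show ?thesis using Suc.prems(2)[of "Suc l" i'] that by blast
    qed
    then have "?mu ((?F ^^ j) (\<phi> i ` (A \<inter> T i)))
        \<le> ennreal (lam ^ j * 2 ^ (n - 1 - card Z)) * ?mu (\<phi> i ` (A \<inter> T i))"
      using Suc.prems by (intro Suc.IH) auto
    also have "\<dots> \<le> ennreal (lam ^ j * 2 ^ (n - 1 - card Z)) * (ennreal lam * ?mu (A \<inter> T i))"
      by (intro mult_left_mono outer_lborel_lipschitz_image_le lip i) simp
    also have "\<dots> = (ennreal (lam ^ j * 2 ^ (n - 1 - card Z)) * ennreal lam) * ?mu (A \<inter> T i)"
      by (simp only: mult.assoc)
    also have "ennreal (lam ^ j * 2 ^ (n - 1 - card Z)) * ennreal lam = C"
      unfolding C_def using lam by (simp add: ennreal_mult[symmetric] mult_ac)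
    finally show ?thesis .
  qed
  have boxes: "?mu ((?F ^^ j) (\<phi> i ` (A \<inter> B i) \<union> \<phi> (Suc i) ` (A \<inter> B i))) \<le> C * ?mu (A \<inter> B i)"
    if i: "i \<in> {1..n - 1}" for i
  proof (cases "i \<in> Z")
    case True
    then have "A \<inter> B i = {}" using Suc.prems(2)[of 0 i] by (simp add: B_def)
    then show ?thesis by (simp add: funpow_fuzzy_image_empty)
  next
    case False
    have fZ: "finite Z" using Suc.prems(1) finite_subset by blast
    have "card (insert i Z) \<le> card {1..n - 1}"
      using Suc.prems(1) i by (intro card_mono) auto
    then have cZ: "n - 1 - card Z = Suc (n - 1 - card (insert i Z))" using fZ False by simp
    define D where "D = ennreal (lam ^ j * 2 ^ (n - 1 - card (insert i Z)))"
    (* Both branches out of box i avoid it from now on, so the induction hypothesis for insert i Z applies. *)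
    have one: "?mu ((?F ^^ j) (\<phi> c ` (A \<inter> B i))) \<le> D * (ennreal lam * ?mu (A \<inter> B i))"
      if c: "c = i \<or> c = Suc i" for c
    proof -
      have cn: "c \<in> {1..n}" using c i by auto
      have sub: "\<phi> c ` (A \<inter> B i) \<subseteq> ?F A"
        unfolding fuzzy_image_def using BJ[OF i] c cn by blast
      have "(?F ^^ l) (\<phi> c ` (A \<inter> B i)) \<inter> {a i'..b i'} = {}" if "l < j" "i' \<in> insert i Z" for l i'
      proof (cases "i' = i")
        case True
        have "y \<notin> {a i..b i}" if y: "y \<in> (?F ^^ l) (\<phi> c ` (A \<inter> B i))" for y
        proof -
          from funpow_fuzzy_image_word[OF y] obtain ws t where
            ws: "t \<in> B i" "length ws = l" "set ws \<subseteq> {1..n}" "y = foldr \<phi> ws (\<phi> c t)" by auto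
          have "ws @ [c] \<noteq> []" "length (ws @ [c]) \<le> k" "set (ws @ [c]) \<subseteq> {1..n}" "t \<in> {a i..b i}"
            using ws cn \<open>l < j\<close> Suc.prems(3) by (auto simp: B_def)
          then have "foldr \<phi> (ws @ [c]) t \<notin> {a i..b i}"
            using nr[OF i] unfolding no_return_def by blast
          then show ?thesis using ws by simp
        qed
        then show ?thesis using True by blast
      next
        case False
        have "(?F ^^ l) (\<phi> c ` (A \<inter> B i)) \<subseteq> (?F ^^ Suc l) A"
          using funpow_fuzzy_image_mono[OF sub] by (simp add: funpow_swap1)
        then show ?thesis using Suc.prems(2)[of "Suc l" i'] that False by blast
      qed
      then have "?mu ((?F ^^ j) (\<phi> c ` (A \<inter> B i))) \<le> D * ?mu (\<phi> c ` (A \<inter> B i))"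
        unfolding D_def using Suc.prems i by (intro Suc.IH) auto
      also have "\<dots> \<le> D * (ennreal lam * ?mu (A \<inter> B i))"
        by (intro mult_left_mono outer_lborel_lipschitz_image_le lip cn) simp
      finally show ?thesis .
    qed
    have "?mu ((?F ^^ j) (\<phi> i ` (A \<inter> B i) \<union> \<phi> (Suc i) ` (A \<inter> B i)))
        \<le> ?mu ((?F ^^ j) (\<phi> i ` (A \<inter> B i))) + ?mu ((?F ^^ j) (\<phi> (Suc i) ` (A \<inter> B i)))"
      unfolding funpow_fuzzy_image_Un by (rule outer_measure_of_Un_le)
    also have "\<dots> \<le> D * (ennreal lam * ?mu (A \<inter> B i)) + D * (ennreal lam * ?mu (A \<inter> B i))"
      using one by (intro add_mono) auto
    also have "\<dots> = ((D + D) * ennreal lam) * ?mu (A \<inter> B i)"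
      by (simp only: distrib_right mult.assoc)
    also have "(D + D) * ennreal lam = C"
      unfolding C_def D_def cZ using lam
      by (simp add: ennreal_plus[symmetric] ennreal_mult[symmetric] mult_ac del: ennreal_plus)
    finally show ?thesis .
  qed
  (* Gaps and boxes as one disjoint family. *)
  define cell where "cell k = (case k of Inl i \<Rightarrow> T i | Inr i \<Rightarrow> B i)" for k :: "nat + nat"
  have "?mu ((?F ^^ Suc j) A) = ?mu ((?F ^^ j) (?F A))" by (simp add: funpow_swap1)
  also have "\<dots> \<le> ?mu ((?F ^^ j) (?P \<union> ?Q))"
    by (intro outer_measure_of_mono funpow_fuzzy_image_mono cover)
  also have "\<dots> \<le> ?mu ((?F ^^ j) ?P) + ?mu ((?F ^^ j) ?Q)"
    unfolding funpow_fuzzy_image_Un[of _ _ _ _ _ ?P ?Q] by (rule outer_measure_of_Un_le)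
  also have "\<dots> \<le> (\<Sum>i\<in>{1..n}. C * ?mu (A \<inter> T i)) + (\<Sum>i\<in>{1..n - 1}. C * ?mu (A \<inter> B i))"
  proof (rule add_mono)
    show "?mu ((?F ^^ j) ?P) \<le> (\<Sum>i\<in>{1..n}. C * ?mu (A \<inter> T i))"
      unfolding funpow_fuzzy_image_UN
      by (rule order_trans[OF outer_measure_of_UN_le_sum sum_mono]) (use pure in auto)
    show "?mu ((?F ^^ j) ?Q) \<le> (\<Sum>i\<in>{1..n - 1}. C * ?mu (A \<inter> B i))"
      unfolding funpow_fuzzy_image_UN
      by (rule order_trans[OF outer_measure_of_UN_le_sum sum_mono]) (use boxes in auto)
  qed
  also have "\<dots> = C * (\<Sum>k\<in>{1..n} <+> {1..n - 1}. ?mu (A \<inter> cell k))"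
    by (simp add: sum.Plus cell_def distrib_left sum_distrib_left)
  also have "\<dots> \<le> C * ?mu A"
  proof (intro mult_left_mono sum_outer_measure_of_Int_le)
    have "cell k \<in> sets borel" for k
    proof (cases k)
      case (Inl i)
      have "T i = (if i = 1 then UNIV else {b (i - 1)<..}) \<inter> (if i = n then UNIV else {..<a i})"
        unfolding T_def by auto
      then show ?thesis using Inl by (auto simp: cell_def)
    qed (simp add: cell_def B_def)
    then show "cell k \<in> sets lborel" for k by simp
    have TT: "T i \<inter> T i' = {}" if "i \<in> {1..n}" "i' \<in> {1..n}" "i < i'" for i i'
    proof -
      have "i \<in> {1..n - 1}" "i' - 1 \<in> {1..n - 1}" "i \<le> i' - 1" using that by auto
      then have "a i \<le> b (i' - 1)" using ab[of i] bmono[of i "i' - 1"] by simp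
      then show ?thesis unfolding T_def using that by auto
    qed
    have BB: "B i \<inter> B i' = {}" if "i \<in> {1..n - 1}" "i' \<in> {1..n - 1}" "i < i'" for i i'
      using ba[OF that] by (auto simp: B_def)
    have TB: "T i \<inter> B i' = {}" if "i \<in> {1..n}" "i' \<in> {1..n - 1}" for i i'
    proof (cases "i' < i")
      case True
      then have "b i' \<le> b (i - 1)" using that by (intro bmono) auto
      then show ?thesis using True that unfolding T_def B_def by auto
    next
      case False
      then have "a i \<le> a i'" using that by (intro amono) auto
      then show ?thesis using False that unfolding T_def B_def by auto
    qed
    show "disjoint_family_on cell ({1..n} <+> {1..n - 1})"
    proof (unfold disjoint_family_on_def, intro ballI impI)
      fix k k' assume k: "k \<in> {1..n} <+> {1..n - 1}" "k' \<in> {1..n} <+> {1..n - 1}" "k \<noteq> k'"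
      show "cell k \<inter> cell k' = {}"
      proof (cases k; cases k')
        fix i i' assume *: "k = Inl i" "k' = Inl i'"
        then have "i < i' \<or> i' < i" "i \<in> {1..n}" "i' \<in> {1..n}" using k by auto
        then show ?thesis unfolding * cell_def sum.case by (metis TT Int_commute)
      next
        fix i i' assume *: "k = Inr i" "k' = Inr i'"
        then have "i < i' \<or> i' < i" "i \<in> {1..n - 1}" "i' \<in> {1..n - 1}" using k by auto
        then show ?thesis unfolding * cell_def sum.case by (metis BB Int_commute)
      next
        fix i i' assume *: "k = Inl i" "k' = Inr i'"
        then have "i \<in> {1..n}" "i' \<in> {1..n - 1}" using k by auto
        then show ?thesis unfolding * cell_def sum.case by (rule TB)
      next
        fix i i' assume *: "k = Inr i" "k' = Inl i'"
        then have "i' \<in> {1..n}" "i \<in> {1..n - 1}" using k by auto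
        then show ?thesis unfolding * cell_def sum.case by (metis TB Int_commute)
      qed
    qed
  qed auto
  finally show ?case unfolding C_def .
qed

text \<open>Each block of \<open>k\<close> steps at least halves the outer measure.\<close>

lemma attractor_null:
  assumes n: "n \<ge> 2"
    and lip: "\<And>i. i \<in> {1..n} \<Longrightarrow> lam-lipschitz_on UNIV (\<phi> i)"
    and ab: "\<And>i. i \<in> {1..n - 1} \<Longrightarrow> a i \<le> b i"
    and ba: "\<And>i j. i \<in> {1..n - 1} \<Longrightarrow> j \<in> {1..n - 1} \<Longrightarrow> i < j \<Longrightarrow> b i < a j"
    and nr: "\<And>i. i \<in> {1..n - 1} \<Longrightarrow> no_return n \<phi> k {a i..b i}"
    and k: "lam ^ k * 2 ^ (n - 1) \<le> 1 / 2"
    and A: "bounded A"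
  shows "(\<Inter>j. (fuzzy_image n \<phi> a b ^^ j) A) \<in> null_sets lebesgue"
proof (rule outer_lborel_zero_null)
  let ?F = "fuzzy_image n \<phi> a b" and ?mu = "outer_measure_of lborel"
  have half: "?mu ((?F ^^ k) B) \<le> ennreal (1 / 2) * ?mu B" for B
  proof -
    have "?mu ((?F ^^ k) B) \<le> ennreal (lam ^ k * 2 ^ (n - 1 - card ({}::nat set))) * ?mu B"
      by (rule outer_funpow_fuzzy_image_le[OF n lip ab ba nr]) auto
    also have "\<dots> \<le> ennreal (1 / 2) * ?mu B" using k by (intro mult_right_mono ennreal_leI) auto
    finally show ?thesis .
  qed
  obtain R where R: "0 < R" "A \<subseteq> {-R..R}"
    using A unfolding bounded_pos by (fastforce simp: abs_le_iff)
  have muA: "?mu A \<le> ennreal (2 * R)"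
    using outer_measure_of_mono[OF R(2), of lborel] R(1) by simp
  have geo: "?mu ((?F ^^ (k * i)) A) \<le> ennreal ((1 / 2) ^ i * (2 * R))" for i
  proof (induction i)
    case 0
    then show ?case using muA by simp
  next
    case (Suc i)
    have "?mu ((?F ^^ (k * Suc i)) A) = ?mu ((?F ^^ k) ((?F ^^ (k * i)) A))"
      by (simp add: funpow_add)
    also have "\<dots> \<le> ennreal (1 / 2) * ?mu ((?F ^^ (k * i)) A)" by (rule half)
    also have "\<dots> \<le> ennreal (1 / 2) * ennreal ((1 / 2) ^ i * (2 * R))"
      using Suc by (intro mult_left_mono) auto
    also have "\<dots> = ennreal ((1 / 2) ^ Suc i * (2 * R))"
      using R(1) by (subst ennreal_mult[symmetric]) auto
    finally show ?case .
  qed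
  have "?mu (\<Inter>j. (?F ^^ j) A) \<le> 0 + ennreal e" if e: "0 < e" for e
  proof -
    have "(\<lambda>i. (1 / 2) ^ i * (2 * R)) \<longlonglongrightarrow> 0"
      by (intro tendsto_mult_left_zero LIMSEQ_realpow_zero) auto
    then have "eventually (\<lambda>i. (1 / 2) ^ i * (2 * R) < e) sequentially"
      using e by (rule order_tendstoD)
    then obtain i where i: "(1 / 2) ^ i * (2 * R) < e"
      unfolding eventually_sequentially by blast
    have "?mu (\<Inter>j. (?F ^^ j) A) \<le> ?mu ((?F ^^ (k * i)) A)"
      by (intro outer_measure_of_mono) blast
    also have "\<dots> \<le> ennreal ((1 / 2) ^ i * (2 * R))" by (rule geo)
    also have "\<dots> \<le> ennreal e" using i by (intro ennreal_leI) simp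
    finally show ?thesis by simp
  qed
  then have "?mu (\<Inter>j. (?F ^^ j) A) \<le> 0" using ennreal_le_epsilon by blast
  then show "?mu (\<Inter>j. (?F ^^ j) A) = 0" by simp
qed

section \<open>Generic breakpoints\<close>

lemma foldr_word_contracts:
  fixes \<phi> :: "nat \<Rightarrow> real \<Rightarrow> real"
  assumes lip: "\<And>i. i \<in> {1..n} \<Longrightarrow> lam-lipschitz_on UNIV (\<phi> i)"
    and ws: "set ws \<subseteq> {1..n}" and lam: "0 \<le> lam"
  shows "\<bar>foldr \<phi> ws s - foldr \<phi> ws t\<bar> \<le> lam ^ length ws * \<bar>s - t :: real\<bar>"
  using ws
proof (induction ws)
  case (Cons i ws)
  have "\<bar>\<phi> i (foldr \<phi> ws s) - \<phi> i (foldr \<phi> ws t)\<bar> \<le> lam * \<bar>foldr \<phi> ws s - foldr \<phi> ws t\<bar>"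
    using lipschitz_onD[OF lip[of i], of "foldr \<phi> ws s" "foldr \<phi> ws t"] Cons.prems
    by (simp add: dist_real_def)
  also have "\<dots> \<le> lam * (lam ^ length ws * \<bar>s - t\<bar>)"
    using Cons lam by (intro mult_left_mono) auto
  finally show ?case by (simp add: mult.assoc)
qed simp

text \<open>A nonempty word is a contraction, so it has at most one fixed point, and there are countably many
  words.\<close>

lemma countable_word_fixed_points:
  fixes \<phi> :: "nat \<Rightarrow> real \<Rightarrow> real"
  assumes lip: "\<And>i. i \<in> {1..n} \<Longrightarrow> lam-lipschitz_on UNIV (\<phi> i)" and lam: "0 \<le> lam" "lam < 1"
  shows "countable {t. \<exists>ws. ws \<noteq> [] \<and> set ws \<subseteq> {1..n} \<and> foldr \<phi> ws t = t}"
proof -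
  have one: "countable {t. ws \<noteq> [] \<and> set ws \<subseteq> {1..n} \<and> foldr \<phi> ws t = t}" (is "countable ?S") for ws
  proof -
    have "s = t" if "s \<in> ?S" "t \<in> ?S" for s t
    proof (rule ccontr)
      assume "s \<noteq> t"
      have "\<bar>foldr \<phi> ws s - foldr \<phi> ws t\<bar> \<le> lam ^ length ws * \<bar>s - t\<bar>"
        by (rule foldr_word_contracts[OF lip _ lam(1)]) (use that in auto)
      then have "\<bar>s - t\<bar> \<le> lam ^ length ws * \<bar>s - t\<bar>" using that by simp
      moreover have "lam ^ length ws < 1" using that lam by (intro power_less_one_iff[THEN iffD2]) auto
      then have "lam ^ length ws * \<bar>s - t\<bar> < 1 * \<bar>s - t\<bar>"
        using \<open>s \<noteq> t\<close> by (intro mult_strict_right_mono) auto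
      ultimately show False by (metis mult_1 not_less)
    qed
    then have "?S = {} \<or> (\<exists>t. ?S = {t})" by blast
    then show ?thesis by (elim disjE exE) (simp_all only: countable_empty countable_insert)
  qed
  have "{t. \<exists>ws. ws \<noteq> [] \<and> set ws \<subseteq> {1..n} \<and> foldr \<phi> ws t = t}
    = (\<Union>ws. {t. ws \<noteq> [] \<and> set ws \<subseteq> {1..n} \<and> foldr \<phi> ws t = t})" by blast
  then show ?thesis using one by simp
qed

lemma no_return_subset: "no_return n \<phi> k T \<Longrightarrow> S \<subseteq> T \<Longrightarrow> no_return n \<phi> k S"
  unfolding no_return_def by blast

text \<open>There are finitely many nonempty words of length at most \<open>k\<close>, so they move \<open>x\<close> by at least some \<open>d > 0\<close>.
  They do not increase distances, so a return to the ball of radius \<open>e\<close> would move \<open>x\<close> by at most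
  \<open>2 * e\<close>.\<close>

lemma eventually_no_return:
  fixes \<phi> :: "nat \<Rightarrow> real \<Rightarrow> real"
  assumes lip: "\<And>i. i \<in> {1..n} \<Longrightarrow> lam-lipschitz_on UNIV (\<phi> i)" and lam: "0 \<le> lam" "lam < 1"
    and x: "\<And>ws. ws \<noteq> [] \<Longrightarrow> set ws \<subseteq> {1..n} \<Longrightarrow> foldr \<phi> ws x \<noteq> x"
  shows "eventually (\<lambda>e. no_return n \<phi> k {x - e..x + e}) (at_right 0)"
proof -
  define Ws where "Ws = {ws. set ws \<subseteq> {1..n} \<and> length ws \<le> k} - {[]}"
  have fin: "finite Ws" unfolding Ws_def using finite_lists_length_le[of "{1..n}" k] by auto
  (* The element 1 keeps the set nonempty for k = 0. *)
  define D where "D = insert 1 ((\<lambda>ws. \<bar>foldr \<phi> ws x - x\<bar>) ` Ws)"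
  have D: "finite D" "D \<noteq> {}" unfolding D_def using fin by auto
  have Dpos: "0 < d" if "d \<in> D" for d
    using that x unfolding D_def Ws_def by fastforce
  define \<eta> where "\<eta> = Min D / 2"
  have \<eta>: "0 < \<eta>" unfolding \<eta>_def using D Dpos by simp
  have "no_return n \<phi> k {x - e..x + e}" if e: "e < \<eta>" for e
    unfolding no_return_def
  proof (intro allI impI notI)
    fix ws t assume ws: "ws \<noteq> []" "length ws \<le> k" "set ws \<subseteq> {1..n}"
      and t: "t \<in> {x - e..x + e}" and ret: "foldr \<phi> ws t \<in> {x - e..x + e}"
    have "\<bar>foldr \<phi> ws x - foldr \<phi> ws t\<bar> \<le> lam ^ length ws * \<bar>x - t\<bar>"
      using foldr_word_contracts[OF lip ws(3) lam(1)] .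
    also have "\<dots> \<le> 1 * \<bar>x - t\<bar>" using lam by (intro mult_right_mono power_le_one) auto
    finally have "\<bar>foldr \<phi> ws x - x\<bar> \<le> 2 * e" using t ret by auto
    moreover have "Min D \<le> \<bar>foldr \<phi> ws x - x\<bar>"
      using D(1) ws unfolding D_def Ws_def by (intro Min_le) auto
    ultimately show False using e unfolding \<eta>_def by simp
  qed
  then show ?thesis unfolding eventually_at_right_field using \<eta> by blast
qed

text \<open>Lists of rationals are used as box endpoints because there are only countably many of them.\<close>

lemma rational_no_return_boxes:
  fixes \<phi> :: "nat \<Rightarrow> real \<Rightarrow> real"
  assumes lip: "\<And>i. i \<in> {1..n} \<Longrightarrow> lam-lipschitz_on UNIV (\<phi> i)" and lam: "0 \<le> lam" "lam < 1"
    and x: "strict_mono_on {1..n - 1} x"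
    and fix_free: "\<And>i ws. i \<in> {1..n - 1} \<Longrightarrow> ws \<noteq> [] \<Longrightarrow> set ws \<subseteq> {1..n} \<Longrightarrow> foldr \<phi> ws (x i) \<noteq> x i"
  obtains as bs :: "rat list" where
    "\<And>i. i \<in> {1..n - 1} \<Longrightarrow> of_rat (as ! i) \<le> x i \<and> x i \<le> of_rat (bs ! i)"
    "\<And>i j. i \<in> {1..n - 1} \<Longrightarrow> j \<in> {1..n - 1} \<Longrightarrow> i < j \<Longrightarrow> (of_rat (bs ! i) :: real) < of_rat (as ! j)"
    "\<And>i. i \<in> {1..n - 1} \<Longrightarrow> no_return n \<phi> k {of_rat (as ! i)..of_rat (bs ! i)}"
proof -
  have ev1: "eventually (\<lambda>e. \<forall>i\<in>{1..n - 1}. no_return n \<phi> k {x i - e..x i + e}) (at_right 0)"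
    using fix_free by (intro eventually_ball_finite ballI eventually_no_return[OF lip lam]) auto
  have gap: "eventually (\<lambda>e. i < j \<longrightarrow> x i + e < x j - e) (at_right 0)"
    if "i \<in> {1..n - 1}" "j \<in> {1..n - 1}" for i j
  proof (cases "i < j")
    case True
    then have "x i < x j" using x that unfolding strict_mono_on_def by blast
    then have "0 < (x j - x i) / 2" "\<forall>e>0. e < (x j - x i) / 2 \<longrightarrow> x i + e < x j - e" by auto
    then have "eventually (\<lambda>e. x i + e < x j - e) (at_right 0)"
      unfolding eventually_at_right_field by blast
    then show ?thesis by eventually_elim simp
  qed simp
  have ev2: "eventually (\<lambda>e. \<forall>i\<in>{1..n - 1}. \<forall>j\<in>{1..n - 1}. i < j \<longrightarrow> x i + e < x j - e) (at_right 0)"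
    using gap by (intro eventually_ball_finite ballI) auto
  have "eventually (\<lambda>e. 0 < e \<and> (\<forall>i\<in>{1..n - 1}. no_return n \<phi> k {x i - e..x i + e}) \<and>
     (\<forall>i\<in>{1..n - 1}. \<forall>j\<in>{1..n - 1}. i < j \<longrightarrow> x i + e < x j - e)) (at_right (0::real))"
    using ev1 ev2 eventually_at_right_less[of 0] by eventually_elim blast
  then obtain e where e: "0 < e" "\<And>i. i \<in> {1..n - 1} \<Longrightarrow> no_return n \<phi> k {x i - e..x i + e}"
     "\<And>i j. i \<in> {1..n - 1} \<Longrightarrow> j \<in> {1..n - 1} \<Longrightarrow> i < j \<Longrightarrow> x i + e < x j - e"
    using eventually_happens'[of "at_right (0::real)"] by (metis (no_types, lifting) trivial_limit_at_right_real)
  have "\<exists>q. x i - e < real_of_rat q \<and> of_rat q < x i" for i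
    using of_rat_dense[of "x i - e" "x i"] e(1) by simp
  then obtain qa where qa: "\<And>i. x i - e < real_of_rat (qa i)" "\<And>i. of_rat (qa i) < x i" by metis
  have "\<exists>q. x i < real_of_rat q \<and> of_rat q < x i + e" for i
    using of_rat_dense[of "x i" "x i + e"] e(1) by simp
  then obtain qb where qb: "\<And>i. x i < real_of_rat (qb i)" "\<And>i. of_rat (qb i) < x i + e" by metis
  define as where "as = map qa [0..<n]"
  define bs where "bs = map qb [0..<n]"
  have nth: "as ! i = qa i \<and> bs ! i = qb i" if "i \<in> {1..n - 1}" for i
    using that unfolding as_def bs_def by (auto simp: nth_map_upt)
  show ?thesis
  proof (rule that)
    fix i assume i: "i \<in> {1..n - 1}"
    show "of_rat (as ! i) \<le> x i \<and> x i \<le> of_rat (bs ! i)"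
      using nth[OF i] qa(2)[of i] qb(1)[of i] by simp
    show "no_return n \<phi> k {of_rat (as ! i)..of_rat (bs ! i)}"
      using nth[OF i] qa(1)[of i] qb(2)[of i]
      by (intro no_return_subset[OF e(2)[OF i]]) auto
  next
    fix i j assume "i \<in> {1..n - 1}" "j \<in> {1..n - 1}" "i < j"
    then show "(of_rat (bs ! i) :: real) < of_rat (as ! j)"
      using nth[of i] nth[of j] e(3)[of i j] qa(1)[of j] qb(2)[of i] by simp
  qed
qed

section \<open>Periodic orbits\<close>

lemma funpow_mult_fixed: "(f ^^ k) t = t \<Longrightarrow> (f ^^ (k * i)) t = t"
  by (induction i) (simp_all add: funpow_add)

lemma orbit_contains: "(f ^^ j) t \<in> orbit f t"
  unfolding orbit_def by blast

lemma orbit_self: "t \<in> orbit f t"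
  using orbit_contains[of 0] by simp

lemma orbit_closed: "s \<in> orbit f t \<Longrightarrow> f s \<in> orbit f t"
proof -
  assume "s \<in> orbit f t"
  then obtain j where "s = (f ^^ j) t" unfolding orbit_def by blast
  then show ?thesis using orbit_contains[of "Suc j" f t] by simp
qed

lemma periodic_orbit_eq:
  assumes "(f ^^ k) t = t" "k \<ge> 1" "s \<in> orbit f t"
  shows "orbit f s = orbit f t"
proof -
  obtain i where i: "s = (f ^^ i) t" using assms(3) unfolding orbit_def by blast
  have "(f ^^ m) t = (f ^^ (m + (k * i - i))) s" for m
  proof -
    have "i \<le> k * i" using \<open>k \<ge> 1\<close> by simp
    then have "m + (k * i - i) + i = m + k * i" by (metis add.assoc le_add_diff_inverse2)
    then have "(f ^^ (m + (k * i - i))) s = (f ^^ (m + k * i)) t"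
      unfolding i by (metis funpow_add o_apply)
    then show ?thesis using funpow_mult_fixed[OF assms(1)] by (simp add: funpow_add)
  qed
  then have "orbit f t \<subseteq> orbit f s" using orbit_contains[of _ f s] unfolding orbit_def[of f t] by auto
  moreover have "(f ^^ m) s = (f ^^ (m + i)) t" for m unfolding i by (simp add: funpow_add)
  then have "orbit f s \<subseteq> orbit f t" using orbit_contains[of _ f t] unfolding orbit_def[of f s] by auto
  ultimately show ?thesis by blast
qed

lemma periodic_orbit_finite:
  assumes "(f ^^ k) t = t" "k \<ge> 1"
  shows "finite (orbit f t)"
proof -
  have "orbit f t \<subseteq> (\<lambda>j. (f ^^ j) t) ` {..<k}"
  proof
    fix s assume "s \<in> orbit f t"
    then obtain j where "s = (f ^^ j) t" unfolding orbit_def by blast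
    then have "s = (f ^^ (j mod k)) t" using funpow_mod_eq[OF assms(1)] by simp
    then show "s \<in> (\<lambda>j. (f ^^ j) t) ` {..<k}" using assms(2) by auto
  qed
  then show ?thesis using finite_surj by blast
qed

text \<open>This is the bound on the number of vertices of a connected graph with edges \<open>e\<close> from \<open>l e\<close> to
  \<open>r e\<close>. Starting from one vertex, a set of vertices is enlarged one vertex at a time along a crossing
  edge. That edge is internal to the enlarged set but not to the previous one, so a set of \<open>j + 1\<close>
  vertices obtained in this way has at least \<open>j\<close> internal edges.\<close>

lemma card_le_Suc_card_if_crossing_edges:
  fixes l r :: "'e \<Rightarrow> 'v"
  assumes V: "finite V" and E: "finite E"
    and cross: "\<And>A. A \<subset> V \<Longrightarrow> A \<noteq> {} \<Longrightarrow>
      \<exists>e\<in>E. l e \<in> A \<and> r e \<in> V - A \<or> r e \<in> A \<and> l e \<in> V - A"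
  shows "card V \<le> Suc (card E)"
proof (cases "V = {}")
  case False
  have grow: "\<exists>A\<subseteq>V. card A = Suc j \<and> j \<le> card {e \<in> E. l e \<in> A \<and> r e \<in> A}"
    if "j < card V" for j
    using that
  proof (induction j)
    case 0
    obtain v where "v \<in> V" using False by blast
    then show ?case by (intro exI[of _ "{v}"]) auto
  next
    case (Suc j)
    then obtain A where A: "A \<subseteq> V" "card A = Suc j" "j \<le> card {e \<in> E. l e \<in> A \<and> r e \<in> A}"
      by auto
    have finA: "finite A" using A V finite_subset by blast
    have "A \<subset> V" "A \<noteq> {}" using A Suc.prems by auto
    then obtain e where e: "e \<in> E" "l e \<in> A \<and> r e \<in> V - A \<or> r e \<in> A \<and> l e \<in> V - A"
      using cross by blast
    then obtain v where v: "v \<in> V - A" "l e \<in> insert v A" "r e \<in> insert v A" "\<not> (l e \<in> A \<and> r e \<in> A)"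
      by blast
    have "insert e {e \<in> E. l e \<in> A \<and> r e \<in> A} \<subseteq> {e \<in> E. l e \<in> insert v A \<and> r e \<in> insert v A}"
      using v e by blast
    then have "card (insert e {e \<in> E. l e \<in> A \<and> r e \<in> A})
        \<le> card {e \<in> E. l e \<in> insert v A \<and> r e \<in> insert v A}"
      using E by (intro card_mono) auto
    moreover have "card (insert e {e \<in> E. l e \<in> A \<and> r e \<in> A}) = Suc (card {e \<in> E. l e \<in> A \<and> r e \<in> A})"
      using v E by (subst card_insert_disjoint) auto
    ultimately have "Suc j \<le> card {e \<in> E. l e \<in> insert v A \<and> r e \<in> insert v A}"
      using A by linarith
    moreover have "insert v A \<subseteq> V" "card (insert v A) = Suc (Suc j)"
      using v A finA by auto
    ultimately show ?case by blast
  qed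
  obtain A where A: "A \<subseteq> V" "card A = Suc (card V - 1)"
      "card V - 1 \<le> card {e \<in> E. l e \<in> A \<and> r e \<in> A}"
    using grow[of "card V - 1"] False V by (auto simp: card_gt_0_iff)
  have "card {e \<in> E. l e \<in> A \<and> r e \<in> A} \<le> card E" using E by (intro card_mono) auto
  with A show ?thesis by linarith
qed simp

text \<open>The periodic orbits are the vertices of a connected graph with edge set \<open>X\<close>, where \<open>e \<in> X\<close> joins the
  orbits of the nearest periodic points on its two sides. To see that a class \<open>A\<close> of orbits is joined
  to its complement, take a closest pair of points from the two classes. It is separated by a point of
  \<open>X\<close>, for otherwise the images of the pair would be even closer. No other periodic point lies between
  the two, as it would form a closer pair with one of them.\<close>

lemma card_periodic_orbits_le:
  fixes f :: "real \<Rightarrow> real"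
  assumes X: "finite X"
    and contr: "\<And>s t. s < t \<Longrightarrow> X \<inter> {s<..t} = {} \<Longrightarrow> \<bar>f s - f t\<bar> < \<bar>s - t\<bar>"
  shows "finite (periodic_orbits UNIV f) \<and> card (periodic_orbits UNIV f) \<le> Suc (card X)"
proof (rule finite_if_finite_subsets_card_bdd)
  fix G assume G: "G \<subseteq> periodic_orbits UNIV f" and finG: "finite G"
  define P where "P = \<Union>G"
  have per: "\<exists>t k. c = orbit f t \<and> k \<ge> 1 \<and> (f ^^ k) t = t" if "c \<in> G" for c
    using that G unfolding periodic_orbits_def by blast
  have orb: "orbit f p = c" if "c \<in> G" "p \<in> c" for c p
    using per[OF that(1)] that(2) periodic_orbit_eq by blast
  have stay: "f p \<in> c" if "c \<in> G" "p \<in> c" for c p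
    using per[OF that(1)] that(2) orbit_closed by blast
  have finP: "finite P" unfolding P_def
    using finG per periodic_orbit_finite by blast
  define l where "l e = orbit f (Max {p \<in> P. p < e})" for e
  define r where "r e = orbit f (Min {p \<in> P. e \<le> p})" for e
  show "card G \<le> Suc (card X)"
  proof (rule card_le_Suc_card_if_crossing_edges[OF finG X])
    fix A assume A: "A \<subset> G" "A \<noteq> {}"
    define cr where "cr p q \<longleftrightarrow> p \<in> P \<and> q \<in> P \<and> (orbit f p \<in> A \<longleftrightarrow> orbit f q \<notin> A)" for p q
    define S where "S = {(p, q). cr p q}"
    have "S \<subseteq> P \<times> P" unfolding S_def cr_def by blast
    then have finS: "finite S" using finP finite_subset by blast
    obtain O1 O2 where c: "O1 \<in> A" "O2 \<in> G" "O2 \<notin> A" using A by blast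
    obtain p1 where p1: "p1 \<in> O1" using per[of O1] c A orbit_self by blast
    obtain p2 where p2: "p2 \<in> O2" using per[of O2] c A orbit_self by blast
    have "orbit f p1 = O1" "orbit f p2 = O2" using orb p1 p2 c A by auto
    then have "cr p1 p2" unfolding cr_def P_def using p1 p2 c A by auto
    then have "S \<noteq> {}" unfolding S_def by blast
    define w where "w = arg_min_on (\<lambda>w. \<bar>fst w - snd w\<bar>) S"
    have w: "w \<in> S" "\<not> (\<exists>w'\<in>S. \<bar>fst w' - snd w'\<bar> < \<bar>fst w - snd w\<bar>)"
      unfolding w_def by (rule arg_min_if_finite[OF finS \<open>S \<noteq> {}\<close>])+
    have sym: "cr q p" if "cr p q" for p q using that unfolding cr_def by blast
    define u v where "u = min (fst w) (snd w)" and "v = max (fst w) (snd w)"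
    have uv: "cr u v" using w(1) sym unfolding u_def v_def S_def min_def max_def by auto
    have "u \<noteq> v" using uv unfolding cr_def by blast
    moreover have "u \<le> v" unfolding u_def v_def by simp
    ultimately have less: "u < v" by simp
    have min: "v - u \<le> \<bar>p - q\<bar>" if "cr p q" for p q
    proof -
      have "(p, q) \<in> S" using that unfolding S_def by blast
      then have "\<not> \<bar>p - q\<bar> < \<bar>fst w - snd w\<bar>" using w(2) by fastforce
      then show ?thesis unfolding u_def v_def by linarith
    qed
    have step: "f p \<in> P \<and> orbit f (f p) = orbit f p" if p: "p \<in> P" for p
    proof -
      obtain c where "c \<in> G" "p \<in> c" using p unfolding P_def by blast
      then show ?thesis using stay[of c p] orb[of c p] orb[of c "f p"] unfolding P_def by auto
    qed
    have "cr (f u) (f v)" using uv step unfolding cr_def by auto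
    then have "\<not> \<bar>f u - f v\<bar> < \<bar>u - v\<bar>" using min less by fastforce
    then obtain e where e: "e \<in> X" "u < e" "e \<le> v" using contr[OF less] by fastforce
    have between: "p \<le> u \<or> v \<le> p" if "p \<in> P" for p
    proof (rule ccontr)
      assume "\<not> (p \<le> u \<or> v \<le> p)"
      moreover have "cr u p \<or> cr p v" using uv that unfolding cr_def by blast
      ultimately show False using min[of u p] min[of p v] by auto
    qed
    have uP: "u \<in> P" "v \<in> P" using uv unfolding cr_def by auto
    have "Max {p \<in> P. p < e} = u"
      using finP uP e between by (intro Max_eqI) force+
    moreover have "Min {p \<in> P. e \<le> p} = v"
      using finP uP e between by (intro Min_eqI) force+
    ultimately have "l e = orbit f u" "r e = orbit f v" unfolding l_def r_def by auto
    moreover have "orbit f u \<in> G" "orbit f v \<in> G" using uP orb unfolding P_def by auto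
    ultimately have "l e \<in> A \<and> r e \<in> G - A \<or> r e \<in> A \<and> l e \<in> G - A"
      using uv unfolding cr_def by auto
    then show "\<exists>e\<in>X. l e \<in> A \<and> r e \<in> G - A \<or> r e \<in> A \<and> l e \<in> G - A"
      using e(1) by (rule rev_bexI[rotated])
  qed
qed

text \<open>By compactness the orbit comes back to within \<open>(1 - lam) * \<rho>\<close> of one of
  its points \<open>u\<close>, after \<open>k\<close> steps, say. Then \<open>f ^^ k\<close> contracts
  the part of \<open>D\<close> in the ball of radius \<open>\<rho>\<close> around \<open>u\<close>, and
  maps it into itself because \<open>lam * \<rho> + (1 - lam) * \<rho> = \<rho>\<close>. So it has a
  fixed point \<open>z\<close> there, and the orbit of \<open>u\<close> is attracted to the orbit of
  \<open>z\<close>.\<close>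

lemma omega_limit_periodic_orbit:
  fixes f :: "real \<Rightarrow> real"
  assumes D: "compact D" "f ` D \<subseteq> D" and lam: "0 \<le> lam" "lam < 1" and \<delta>: "0 < \<delta>"
    and loc: "\<And>s t. s \<in> D \<Longrightarrow> t \<in> D \<Longrightarrow> \<bar>s - t\<bar> < \<delta> \<Longrightarrow> \<bar>f s - f t\<bar> \<le> lam * \<bar>s - t\<bar>"
    and t: "(f ^^ m) t \<in> D"
  shows "omega_limit f t \<in> periodic_orbits UNIV f"
proof -
  have inD: "(f ^^ j) s \<in> D" if "s \<in> D" for j s
    using that D(2) by (induction j) auto
  have iter: "\<bar>(f ^^ j) r - (f ^^ j) s\<bar> \<le> lam ^ j * \<bar>r - s\<bar>" if "r \<in> D" "s \<in> D" "\<bar>r - s\<bar> < \<delta>" for j r s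
  proof (induction j)
    case (Suc j)
    have "lam ^ j * \<bar>r - s\<bar> \<le> 1 * \<bar>r - s\<bar>" using lam by (intro mult_right_mono power_le_one) auto
    then have "\<bar>(f ^^ j) r - (f ^^ j) s\<bar> \<le> \<bar>r - s\<bar>" using Suc.IH by (metis mult_1 order_trans)
    then have "\<bar>(f ^^ j) r - (f ^^ j) s\<bar> < \<delta>" using that(3) by (rule le_less_trans)
    then have "\<bar>(f ^^ Suc j) r - (f ^^ Suc j) s\<bar> \<le> lam * \<bar>(f ^^ j) r - (f ^^ j) s\<bar>"
      using loc[OF inD[OF that(1)] inD[OF that(2)]] by simp
    also have "\<dots> \<le> lam * (lam ^ j * \<bar>r - s\<bar>)" using Suc lam by (intro mult_left_mono)
    finally show ?case by (simp add: mult.assoc)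
  qed simp
  (* Any two points of a ball of radius \<rho> are closer than \<delta>, so that f contracts their distance. *)
  define \<rho> where "\<rho> = \<delta> / 3"
  have \<rho>: "0 < \<rho>" "2 * \<rho> < \<delta>" using \<delta> unfolding \<rho>_def by auto
  define orb where "orb i = (f ^^ i) ((f ^^ m) t)" for i
  have orbD: "orb i \<in> D" for i unfolding orb_def using inD[OF t] .
  obtain y h where h: "strict_mono h" "(orb \<circ> h) \<longlonglongrightarrow> y"
    using D(1) orbD unfolding compact_def by metis
  have "Cauchy (orb \<circ> h)" using h(2) LIMSEQ_imp_Cauchy by blast
  then obtain N where N: "\<And>i j. i \<ge> N \<Longrightarrow> j \<ge> N \<Longrightarrow> dist (orb (h i)) (orb (h j)) < (1 - lam) * \<rho>"
    unfolding Cauchy_def using lam \<rho> by (metis comp_apply diff_gt_0_iff_gt mult_pos_pos)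
  define p where "p = h N"
  define k where "k = h (Suc N) - h N"
  define u where "u = orb p"
  have hN: "h N < h (Suc N)" using h(1) by (simp add: strict_mono_Suc_iff)
  then have k: "k \<ge> 1" unfolding k_def by simp
  have fku: "(f ^^ k) u = orb (h (Suc N))"
    unfolding u_def orb_def k_def p_def using hN
    by (metis add_diff_inverse_nat add.commute funpow_add not_less_iff_gr_or_eq o_apply)
  have close: "\<bar>(f ^^ k) u - u\<bar> \<le> (1 - lam) * \<rho>"
    using N[of "Suc N" N] fku unfolding u_def p_def dist_real_def by simp
  have uD: "u \<in> D" unfolding u_def by (rule orbD)
  define S where "S = D \<inter> cball u \<rho>"
  have lamk: "lam ^ k \<le> lam" using lam k by (metis less_eq_real_def power_decreasing power_one_right)
  have Sc: "\<bar>(f ^^ k) r - (f ^^ k) s\<bar> \<le> lam * \<bar>r - s\<bar>" if "r \<in> S" "s \<in> S" for r s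
  proof -
    have "\<bar>r - s\<bar> < \<delta>" using that \<rho> unfolding S_def by (auto simp: dist_real_def)
    then have "\<bar>(f ^^ k) r - (f ^^ k) s\<bar> \<le> lam ^ k * \<bar>r - s\<bar>"
      using iter that unfolding S_def by blast
    also have "\<dots> \<le> lam * \<bar>r - s\<bar>" using lamk by (intro mult_right_mono) auto
    finally show ?thesis .
  qed
  have uS: "u \<in> S" unfolding S_def using uD \<rho> by simp
  have "\<exists>!z\<in>S. (f ^^ k) z = z"
  proof (rule Banach_fix)
    show "complete S" unfolding S_def
      using D(1) by (intro compact_imp_complete compact_Int_closed) auto
    show "S \<noteq> {}" using uS by blast
    show "(f ^^ k) ` S \<subseteq> S"
    proof
      fix y assume "y \<in> (f ^^ k) ` S"
      then obtain s where s: "s \<in> S" "y = (f ^^ k) s" by blast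
      have "lam * \<bar>s - u\<bar> \<le> lam * \<rho>"
        using s(1) lam unfolding S_def by (intro mult_left_mono) (auto simp: dist_real_def)
      then have "\<bar>(f ^^ k) s - u\<bar> \<le> \<rho>"
        using Sc[OF s(1) uS] close by (simp add: algebra_simps)
      then show "y \<in> S" using s inD unfolding S_def by (auto simp: dist_real_def)
    qed
    show "dist ((f ^^ k) r) ((f ^^ k) s) \<le> lam * dist r s" if "r \<in> S" "s \<in> S" for r s
      using Sc[OF that] by (simp add: dist_real_def)
  qed (use lam in auto)
  then obtain z where z: "z \<in> S" "(f ^^ k) z = z" by blast
  have zD: "z \<in> D" "\<bar>u - z\<bar> < \<delta>" using z(1) \<rho> unfolding S_def by (auto simp: dist_real_def)
  define M where "M = p + m"
  have fM: "(f ^^ (M + j)) t = (f ^^ j) u" for j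
    unfolding M_def u_def orb_def by (metis add.commute funpow_add o_apply)
  have conv: "(\<lambda>j. lam ^ j * \<bar>u - z\<bar>) \<longlonglongrightarrow> 0"
    using lam by (intro tendsto_mult_left_zero LIMSEQ_realpow_zero)
  have near: "\<exists>J. \<forall>j\<ge>J. \<bar>(f ^^ j) u - (f ^^ j) z\<bar> < e" if e: "0 < e" for e
  proof -
    have "eventually (\<lambda>j. lam ^ j * \<bar>u - z\<bar> < e) sequentially"
      using order_tendstoD(2)[OF conv e] .
    then obtain J where "\<And>j. j \<ge> J \<Longrightarrow> lam ^ j * \<bar>u - z\<bar> < e"
      unfolding eventually_sequentially by blast
    then show ?thesis using iter[OF uD zD] by (meson le_less_trans)
  qed
  have "omega_limit f t = orbit f z"
  proof
    show "orbit f z \<subseteq> omega_limit f t"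
    proof
      fix y assume "y \<in> orbit f z"
      then obtain i where y: "y = (f ^^ i) z" unfolding orbit_def by blast
      show "y \<in> omega_limit f t" unfolding omega_limit_def
      proof (intro INT_I)
        fix m'
        show "y \<in> closure (\<Union>k\<in>{m'..}. {(f ^^ k) t})"
          unfolding closure_approachable
        proof (intro allI impI)
          fix e :: real assume "0 < e"
          then obtain J where J: "\<And>j. j \<ge> J \<Longrightarrow> \<bar>(f ^^ j) u - (f ^^ j) z\<bar> < e" using near by blast
          define j where "j = i + k * (J + m')"
          have "J + m' \<le> k * (J + m')" using k by simp
          then have "j \<ge> J" "M + j \<ge> m'" unfolding j_def by linarith+
          moreover have "(f ^^ j) z = y"
            unfolding j_def y using funpow_mult_fixed[OF z(2)] by (simp add: funpow_add)
          ultimately have "dist ((f ^^ (M + j)) t) y < e"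
            using J[of j] unfolding fM by (simp add: dist_real_def)
          with \<open>M + j \<ge> m'\<close> show "\<exists>y'\<in>\<Union>k\<in>{m'..}. {(f ^^ k) t}. dist y' y < e" by blast
        qed
      qed
    qed
    show "omega_limit f t \<subseteq> orbit f z"
    proof
      fix y assume y: "y \<in> omega_limit f t"
      have "closed (orbit f z)"
        using periodic_orbit_finite[OF z(2) k] by (rule finite_imp_closed)
      moreover have "y \<in> closure (orbit f z)"
        unfolding closure_approachable
      proof (intro allI impI)
        fix e :: real assume e: "0 < e"
        then obtain J where J: "\<And>j. j \<ge> J \<Longrightarrow> \<bar>(f ^^ j) u - (f ^^ j) z\<bar> < e / 2"
          using near[of "e / 2"] by auto
        have "y \<in> closure (\<Union>k\<in>{M + J..}. {(f ^^ k) t})" using y unfolding omega_limit_def by blast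
        then obtain i where i: "i \<ge> M + J" "dist ((f ^^ i) t) y < e / 2"
          unfolding closure_approachable using e by (metis (no_types, lifting) UN_iff atLeast_iff half_gt_zero singletonD)
        have "(f ^^ i) t = (f ^^ (i - M)) u" using fM[of "i - M"] i by simp
        moreover have "i - M \<ge> J" using i by simp
        ultimately have "dist ((f ^^ (i - M)) z) y < e"
          using J[of "i - M"] i(2) unfolding dist_real_def by linarith
        then show "\<exists>y'\<in>orbit f z. dist y' y < e" using orbit_contains by blast
      qed
      ultimately show "y \<in> orbit f z" by (simp add: closure_closed)
    qed
  qed
  then show ?thesis unfolding periodic_orbits_def using z(2) k by blast
qed

section \<open>Piecewise contractions\<close>

lemma pc_eqI:
  assumes n: "n \<ge> 2" and x: "strict_mono_on {1..n - 1} x" and i: "i \<in> {1..n}"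
    and t: "i = 1 \<or> x (i - 1) \<le> t" "i = n \<or> t < x i"
  shows "pc n \<phi> x t = \<phi> i t"
proof -
  consider "i = 1" | "i = n" "i \<noteq> 1" | "i \<in> {2..n - 1}" using i by fastforce
  then show ?thesis
  proof cases
    case 1
    then show ?thesis using t n by (simp add: pc_def)
  next
    case 2
    have "x 1 \<le> x (n - 1)" using n by (intro strict_mono_on_leD[OF x]) auto
    then show ?thesis using t 2 by (simp add: pc_def)
  next
    case 3
    have le: "x 1 \<le> x (i - 1)" using 3 by (intro strict_mono_on_leD[OF x]) auto
    have le': "x i \<le> x (n - 1)" using 3 by (intro strict_mono_on_leD[OF x]) auto
    have t': "x (i - 1) \<le> t" "t < x i" using t 3 n by auto
    have "(THE i. i \<in> {2..n - 1} \<and> t \<in> {x (i - 1)..<x i}) = i"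
      using pc_index_unique[OF x _ _ n, of t] le le' t' 3 by (intro the1_equality) auto
    then show ?thesis using le le' t' by (simp add: pc_def)
  qed
qed

lemma pc_index_exists:
  fixes x :: "nat \<Rightarrow> real"
  assumes n: "n \<ge> 2" and x: "strict_mono_on {1..n - 1} x"
  obtains i where "i \<in> {1..n}" "i = 1 \<or> x (i - 1) \<le> t" "i = n \<or> t < x i"
proof -
  consider "t < x 1" | "x (n - 1) \<le> t" | "x 1 \<le> t" "t < x (n - 1)" by (meson not_less)
  then show ?thesis
  proof cases
    case 1
    then show ?thesis using that[of 1] n by simp
  next
    case 2
    then show ?thesis using that[of n] n by simp
  next
    case 3
    then obtain i where "i \<in> {2..n - 1}" "t \<in> {x (i - 1)..<x i}"
      using pc_index_unique[OF x _ _ n] by blast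
    then show ?thesis using that[of i] by auto
  qed
qed

lemma pc_contracts_between_breakpoints:
  assumes n: "n \<ge> 2" and x: "strict_mono_on {1..n - 1} x"
    and lip: "\<And>i. i \<in> {1..n} \<Longrightarrow> lam-lipschitz_on UNIV (\<phi> i)"
    and st: "s < t" and no: "x ` {1..n - 1} \<inter> {s<..t} = {}"
  shows "\<bar>pc n \<phi> x s - pc n \<phi> x t\<bar> \<le> lam * \<bar>s - t\<bar>"
proof -
  obtain i where i: "i \<in> {1..n}" "i = 1 \<or> x (i - 1) \<le> s" "i = n \<or> s < x i"
    using pc_index_exists[OF n x] .
  have "i = n \<or> t < x i"
  proof (cases "i = n")
    case False
    then have "i \<in> {1..n - 1}" using i by auto
    then have "x i \<notin> {s<..t}" using no by blast
    then show ?thesis using i(3) by auto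
  qed simp
  moreover have "i = 1 \<or> x (i - 1) \<le> t" using i(2) st by auto
  ultimately have "pc n \<phi> x s = \<phi> i s" "pc n \<phi> x t = \<phi> i t"
    using pc_eqI[OF n x i] pc_eqI[OF n x i(1)] by auto
  then show ?thesis using lipschitz_onD[OF lip[OF i(1)], of s t] by (simp add: dist_real_def)
qed

lemma pc_image_subset_fuzzy_image:
  assumes n: "n \<ge> 2" and x: "strict_mono_on {1..n - 1} x"
    and box: "\<And>i. i \<in> {1..n - 1} \<Longrightarrow> a i \<le> x i \<and> x i \<le> b i"
  shows "pc n \<phi> x ` A \<subseteq> fuzzy_image n \<phi> a b A"
proof
  fix y assume "y \<in> pc n \<phi> x ` A"
  then obtain t where t: "t \<in> A" "y = pc n \<phi> x t" by blast
  obtain i where i: "i \<in> {1..n}" "i = 1 \<or> x (i - 1) \<le> t" "i = n \<or> t < x i"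
    using pc_index_exists[OF n x] .
  have "i - 1 \<in> {1..n - 1}" if "i \<noteq> 1" using i(1) that by auto
  then have "a (i - 1) \<le> x (i - 1)" if "i \<noteq> 1" using box that by blast
  moreover have "i \<in> {1..n - 1}" if "i \<noteq> n" using i(1) that by auto
  then have "x i \<le> b i" if "i \<noteq> n" using box that by blast
  ultimately have "t \<in> fuzzy_piece n a b i" using i unfolding fuzzy_piece_def by force
  moreover have "y = \<phi> i t" using t pc_eqI[OF n x i] by simp
  ultimately show "y \<in> fuzzy_image n \<phi> a b A" unfolding fuzzy_image_def using t i(1) by blast
qed

text \<open>The iterates of \<open>C\<close> under the blurred map decrease, so one of them contains none of the finitely
  many breakpoints. It is a compact set mapped into itself by \<open>pc n \<phi> x\<close>, at positive distance from
  the breakpoints.\<close>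

lemma asymptotically_periodic_if_breakpoints_escape:
  assumes n: "n \<ge> 2" and x: "strict_mono_on {1..n - 1} x"
    and lip: "\<And>i. i \<in> {1..n} \<Longrightarrow> lam-lipschitz_on UNIV (\<phi> i)" and lam: "0 \<le> lam" "lam < 1"
    and box: "\<And>i. i \<in> {1..n - 1} \<Longrightarrow> a i \<le> x i \<and> x i \<le> b i"
    and C: "compact C" "\<And>i. i \<in> {1..n} \<Longrightarrow> \<phi> i ` C \<subseteq> C"
    and absorb: "\<And>t. \<exists>m. (pc n \<phi> x ^^ m) t \<in> C"
    and esc: "\<And>i. i \<in> {1..n - 1} \<Longrightarrow> x i \<notin> (\<Inter>j. (fuzzy_image n \<phi> a b ^^ j) C)"
  shows "asymptotically_periodic UNIV (pc n \<phi> x)"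
proof -
  let ?f = "pc n \<phi> x" and ?F = "fuzzy_image n \<phi> a b"
  have FC: "?F C \<subseteq> C" unfolding fuzzy_image_def using C(2) by blast
  have "(?F ^^ Suc j) C \<subseteq> (?F ^^ j) C" for j
    using funpow_fuzzy_image_mono[OF FC] by (simp add: funpow_swap1)
  then have anti: "(?F ^^ j') C \<subseteq> (?F ^^ j) C" if "j \<le> j'" for j j'
    using that by (rule lift_Suc_antimono_le)
  have "\<forall>i\<in>{1..n - 1}. \<exists>j. x i \<notin> (?F ^^ j) C" using esc by blast
  then obtain g where g: "\<And>i. i \<in> {1..n - 1} \<Longrightarrow> x i \<notin> (?F ^^ g i) C" by metis
  define J where "J = Max (g ` {1..n - 1})"
  define D where "D = (?F ^^ J) C"
  have xD: "x i \<notin> D" if i: "i \<in> {1..n - 1}" for i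
  proof -
    have "g i \<le> J" unfolding J_def using i by (intro Max_ge) auto
    then show ?thesis using anti g[OF i] unfolding D_def by blast
  qed
  have compF: "compact ((?F ^^ j) C)" for j
    by (induction j) (use C(1) compact_fuzzy_image[OF lip] in auto)
  have D: "compact D" unfolding D_def by (rule compF)
  have imF: "?f ` A \<subseteq> ?F A" for A by (rule pc_image_subset_fuzzy_image[OF n x box])
  have fD: "?f ` D \<subseteq> D"
    using imF[of D] anti[of J "Suc J"] unfolding D_def by simp
  have fC: "(?f ^^ j) t \<in> (?F ^^ j) C" if "t \<in> C" for j t
    using that imF by (induction j) fastforce+
  have "closed (x ` {1..n - 1})" by (intro finite_imp_closed) simp
  moreover have "D \<inter> x ` {1..n - 1} = {}" using xD by blast
  ultimately obtain \<delta> where \<delta>: "0 < \<delta>" "\<And>s y. s \<in> D \<Longrightarrow> y \<in> x ` {1..n - 1} \<Longrightarrow> \<delta> \<le> dist s y"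
    using separate_compact_closed[OF D] by metis
  have loc1: "\<bar>?f s - ?f t\<bar> \<le> lam * \<bar>s - t\<bar>" if "s \<in> D" "t \<in> D" "\<bar>s - t\<bar> < \<delta>" "s < t" for s t
  proof (rule pc_contracts_between_breakpoints[OF n x lip that(4)])
    show "x ` {1..n - 1} \<inter> {s<..t} = {}"
    proof (rule ccontr)
      assume "x ` {1..n - 1} \<inter> {s<..t} \<noteq> {}"
      then obtain y where "y \<in> x ` {1..n - 1}" "y \<in> {s<..t}" by blast
      then show False using \<delta>(2)[OF that(2), of y] that(3,4) by (auto simp add: dist_real_def)
    qed
  qed
  have loc: "\<bar>?f s - ?f t\<bar> \<le> lam * \<bar>s - t\<bar>" if "s \<in> D" "t \<in> D" "\<bar>s - t\<bar> < \<delta>" for s t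
    using that loc1[of s t] loc1[of t s]
    by (cases s t rule: linorder_cases) (simp_all add: abs_minus_commute)
  have "omega_limit ?f t \<in> periodic_orbits UNIV ?f" for t
  proof -
    obtain m where "(?f ^^ m) t \<in> C" using absorb by blast
    then have "(?f ^^ (J + m)) t \<in> D" unfolding D_def using fC by (simp add: funpow_add)
    then show ?thesis by (intro omega_limit_periodic_orbit[OF D fD lam \<delta>(1)] loc)
  qed
  then show ?thesis unfolding asymptotically_periodic_def by blast
qed

text \<open>The full set \<open>W\<close> is chosen before the breakpoints: it omits the fixed points of all words and every
  null set \<open>N p\<close> arising from a pair \<open>p\<close> of lists of box endpoints. For given breakpoints in \<open>W\<close> one of
  these pairs consists of boxes without early return around them, hence its \<open>N p\<close> is null and the
  breakpoints lie outside it.\<close>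

lemma generic_pc_on_line:
  fixes \<phi> :: "nat \<Rightarrow> real \<Rightarrow> real"
  assumes n: "n \<ge> 2"
    and lip: "\<And>i. i \<in> {1..n} \<Longrightarrow> lam-lipschitz_on UNIV (\<phi> i)" and lam: "0 \<le> lam" "lam < 1"
  shows "\<exists>W. - W \<in> null_sets lebesgue \<and>
    (\<forall>x. strict_mono_on {1..n - 1} x \<longrightarrow> x ` {1..n - 1} \<subseteq> W \<longrightarrow>
       asymptotically_periodic UNIV (pc n \<phi> x) \<and>
       finite (periodic_orbits UNIV (pc n \<phi> x)) \<and> card (periodic_orbits UNIV (pc n \<phi> x)) \<le> n)"
proof -
  (* The interval of radius R is preserved, since every image of t has modulus at most
     lam * |t| + (1 - lam) * R; the larger interval C is entered by every orbit in finite time. *)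
  define R where "R = Max ((\<lambda>i. \<bar>\<phi> i 0\<bar>) ` {1..n}) / (1 - lam)"
  have R: "\<bar>\<phi> i 0\<bar> \<le> (1 - lam) * R" if "i \<in> {1..n}" for i
  proof -
    have "\<bar>\<phi> i 0\<bar> \<le> Max ((\<lambda>i. \<bar>\<phi> i 0\<bar>) ` {1..n})" using that by (intro Max_ge) auto
    then show ?thesis unfolding R_def using lam by simp
  qed
  have R0: "0 \<le> R"
  proof -
    have "0 \<le> (1 - lam) * R" using R[of 1] n by fastforce
    then show ?thesis using lam by (simp add: zero_le_mult_iff)
  qed
  have grow: "\<bar>\<phi> i t\<bar> \<le> lam * \<bar>t\<bar> + (1 - lam) * R" if "i \<in> {1..n}" for i t
    using lipschitz_onD[OF lip[OF that], of t 0] R[OF that] by (simp add: dist_real_def)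
  define C where "C = {- (R + 1)..R + 1}"
  have CC: "\<phi> i ` C \<subseteq> C" if "i \<in> {1..n}" for i
  proof
    fix y assume "y \<in> \<phi> i ` C"
    then obtain t where "t \<in> C" and ty: "y = \<phi> i t" by blast
    then have t: "\<bar>t\<bar> \<le> R + 1" unfolding C_def by auto
    have "lam * \<bar>t\<bar> \<le> lam * (R + 1)" using t lam by (intro mult_left_mono)
    then have "\<bar>y\<bar> \<le> R + 1" using grow[OF that, of t] ty lam by (simp add: algebra_simps)
    then show "y \<in> C" unfolding C_def by auto
  qed
  define N where "N p = (\<Inter>j. (fuzzy_image n \<phi> (\<lambda>i. of_rat (fst p ! i)) (\<lambda>i. of_rat (snd p ! i)) ^^ j) C)"
    for p :: "rat list \<times> rat list"
  define Fx where "Fx = {t. \<exists>ws. ws \<noteq> [] \<and> set ws \<subseteq> {1..n} \<and> foldr \<phi> ws t = t}"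
  define W where "W = - (Fx \<union> (\<Union>p\<in>{p. N p \<in> null_sets lebesgue}. N p))"
  have "Fx \<in> null_sets lebesgue"
    using countable_word_fixed_points[OF lip lam] unfolding Fx_def
    by (intro null_sets_completionI countable_imp_null_set_lborel)
  moreover have "(\<Union>p\<in>{p. N p \<in> null_sets lebesgue}. N p) \<in> null_sets lebesgue"
    by (intro null_sets_UN') auto
  ultimately have "- W \<in> null_sets lebesgue" unfolding W_def double_compl by (rule null_sets.Un)
  moreover have "asymptotically_periodic UNIV (pc n \<phi> x) \<and>
       finite (periodic_orbits UNIV (pc n \<phi> x)) \<and> card (periodic_orbits UNIV (pc n \<phi> x)) \<le> n"
    if x: "strict_mono_on {1..n - 1} x" and xW: "x ` {1..n - 1} \<subseteq> W" for x
  proof -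
    have "(\<lambda>k. lam ^ k * 2 ^ (n - 1)) \<longlonglongrightarrow> 0"
      using lam by (intro tendsto_mult_left_zero LIMSEQ_realpow_zero) auto
    then have "eventually (\<lambda>k. lam ^ k * 2 ^ (n - 1) < 1 / 2) sequentially"
      by (rule order_tendstoD) simp
    then obtain k where k: "lam ^ k * 2 ^ (n - 1) \<le> 1 / 2"
      unfolding eventually_sequentially by (meson order_refl less_imp_le)
    have ff: "foldr \<phi> ws (x i) \<noteq> x i" if "i \<in> {1..n - 1}" "ws \<noteq> []" "set ws \<subseteq> {1..n}" for i ws
    proof -
      have "x i \<notin> Fx" using that(1) xW unfolding W_def by blast
      then show ?thesis using that unfolding Fx_def by blast
    qed
    obtain as bs :: "rat list" where box:
      "\<And>i. i \<in> {1..n - 1} \<Longrightarrow> of_rat (as ! i) \<le> x i \<and> x i \<le> of_rat (bs ! i)"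
      "\<And>i j. i \<in> {1..n - 1} \<Longrightarrow> j \<in> {1..n - 1} \<Longrightarrow> i < j \<Longrightarrow> (of_rat (bs ! i) :: real) < of_rat (as ! j)"
      "\<And>i. i \<in> {1..n - 1} \<Longrightarrow> no_return n \<phi> k {of_rat (as ! i)..of_rat (bs ! i)}"
      using rational_no_return_boxes[OF lip lam x ff, where k = k] by blast
    have "N (as, bs) \<in> null_sets lebesgue"
      unfolding N_def fst_conv snd_conv
    proof (rule attractor_null[OF n lip _ _ _ k])
      show "real_of_rat (as ! i) \<le> of_rat (bs ! i)" if "i \<in> {1..n - 1}" for i
        using box(1)[OF that] by linarith
      show "bounded C" unfolding C_def by simp
    qed (use box in auto)
    then have esc: "x i \<notin> N (as, bs)" if "i \<in> {1..n - 1}" for i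
      using that xW unfolding W_def by blast
    let ?f = "pc n \<phi> x"
    have f_grow: "\<bar>?f t\<bar> \<le> lam * \<bar>t\<bar> + (1 - lam) * R" for t
    proof -
      obtain i where i: "i \<in> {1..n}" "i = 1 \<or> x (i - 1) \<le> t" "i = n \<or> t < x i"
        using pc_index_exists[OF n x] .
      then show ?thesis using pc_eqI[OF n x i] grow[OF i(1)] by simp
    qed
    have iter: "\<bar>(?f ^^ m) t\<bar> \<le> lam ^ m * \<bar>t\<bar> + R" for m t
    proof (induction m)
      case (Suc m)
      have "\<bar>(?f ^^ Suc m) t\<bar> \<le> lam * \<bar>(?f ^^ m) t\<bar> + (1 - lam) * R" using f_grow by simp
      also have "\<dots> \<le> lam * (lam ^ m * \<bar>t\<bar> + R) + (1 - lam) * R"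
        using Suc lam by (intro add_right_mono mult_left_mono)
      finally show ?case by (simp add: algebra_simps)
    qed (use R0 in simp)
    have absorb: "\<exists>m. (?f ^^ m) t \<in> C" for t
    proof -
      have "(\<lambda>m. lam ^ m * \<bar>t\<bar>) \<longlonglongrightarrow> 0"
        using lam by (intro tendsto_mult_left_zero LIMSEQ_realpow_zero) auto
      then have "eventually (\<lambda>m. lam ^ m * \<bar>t\<bar> < 1) sequentially"
        by (rule order_tendstoD) simp
      then obtain m where "lam ^ m * \<bar>t\<bar> < 1" unfolding eventually_sequentially by blast
      then have "\<bar>(?f ^^ m) t\<bar> \<le> R + 1" using iter[of m t] by linarith
      then show ?thesis unfolding C_def by (intro exI[of _ m]) auto
    qed
    have "asymptotically_periodic UNIV ?f"
    proof (rule asymptotically_periodic_if_breakpoints_escape[OF n x lip lam box(1) _ CC absorb])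
      show "compact C" unfolding C_def by simp
      show "x i \<notin> (\<Inter>j. (fuzzy_image n \<phi> (\<lambda>i. of_rat (as ! i)) (\<lambda>i. of_rat (bs ! i)) ^^ j) C)"
        if "i \<in> {1..n - 1}" for i
        using esc[OF that] unfolding N_def by simp
    qed
    moreover have "finite (periodic_orbits UNIV ?f) \<and> card (periodic_orbits UNIV ?f) \<le> Suc (card (x ` {1..n - 1}))"
    proof (rule card_periodic_orbits_le)
      show "\<bar>?f s - ?f t\<bar> < \<bar>s - t\<bar>" if "s < t" "x ` {1..n - 1} \<inter> {s<..t} = {}" for s t
      proof -
        have "\<bar>?f s - ?f t\<bar> \<le> lam * \<bar>s - t\<bar>"
          by (rule pc_contracts_between_breakpoints[OF n x lip that])
        also have "\<dots> < 1 * \<bar>s - t\<bar>" using that(1) lam by (intro mult_strict_right_mono) auto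
        finally show ?thesis by simp
      qed
    qed simp
    moreover have "Suc (card (x ` {1..n - 1})) \<le> n"
      using card_image_le[of "{1..n - 1}" x] n by simp
    ultimately show ?thesis by linarith
  qed
  ultimately show ?thesis by blast
qed

section \<open>The interval and the line together\<close>

text \<open>Composing with this retraction extends the maps of an iterated function system to the whole line
  without increasing their Lipschitz constants.\<close>

lemma nonexpansive_retraction_exists:
  fixes I :: "real set"
  assumes "I = {0..<1} \<or> I = UNIV"
  obtains p where "\<And>t. p t \<in> closure I" "\<And>t. t \<in> I \<Longrightarrow> p t = t" "1-lipschitz_on UNIV p"
proof (cases "I = UNIV")
  case True
  then show ?thesis by (intro that[of "\<lambda>t. t"]) (auto intro: lipschitz_onI)
next
  case False
  then have I: "I = {0..<1}" using assms by blast
  show ?thesis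
  proof (rule that[of "\<lambda>t. max 0 (min 1 t)"])
    show "1-lipschitz_on UNIV (\<lambda>t::real. max 0 (min 1 t))"
      by (rule lipschitz_onI) (auto simp: dist_real_def max_def min_def)
  qed (auto simp: I)
qed

theorem theorem1p2:
  fixes I :: "real set" and n :: nat and \<phi> :: "nat \<Rightarrow> real \<Rightarrow> real"
  assumes "I = {0..<1} \<or> I = UNIV"
    and "n \<ge> 2"
    and "is_IFS I n \<phi>"
  shows "\<exists>W. full_set I W \<and>
    (\<forall>x \<in> Omega (n - 1) I \<inter> ({1..n - 1} \<rightarrow>\<^sub>E W).
       asymptotically_periodic I (pc n \<phi> x) \<and>
       finite (periodic_orbits I (pc n \<phi> x)) \<and> card (periodic_orbits I (pc n \<phi> x)) \<le> n)"
proof -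
  obtain p where p: "\<And>t. p t \<in> closure I" "\<And>t. t \<in> I \<Longrightarrow> p t = t" "1-lipschitz_on UNIV p"
    by (rule nonexpansive_retraction_exists[OF assms(1)]) (rule that)
  have ifs: "\<phi> i \<in> closure I \<rightarrow> interior I" "\<exists>L<1. L-lipschitz_on (closure I) (\<phi> i)"
    if "i \<in> {1..n}" for i
    using assms(3) that unfolding is_IFS_def by blast+
  obtain L where L: "\<And>i. i \<in> {1..n} \<Longrightarrow> L i < 1 \<and> (L i)-lipschitz_on (closure I) (\<phi> i)"
    using ifs(2) by metis
  define lam where "lam = Max (L ` {1..n})"
  have lam1: "lam < 1" unfolding lam_def using L \<open>n \<ge> 2\<close> by (subst Max_less_iff) auto
  have lip: "lam-lipschitz_on (closure I) (\<phi> i)" if "i \<in> {1..n}" for i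
  proof (rule lipschitz_on_le)
    show "(L i)-lipschitz_on (closure I) (\<phi> i)" using L[OF that] by blast
    show "L i \<le> lam" unfolding lam_def using that by (intro Max_ge) auto
  qed
  have lam0: "0 \<le> lam" using lip[of 1] \<open>n \<ge> 2\<close> lipschitz_on_nonneg by auto
  define \<psi> where "\<psi> i = \<phi> i \<circ> p" for i
  have lip_psi: "lam-lipschitz_on UNIV (\<psi> i)" if "i \<in> {1..n}" for i
  proof -
    have "lam-lipschitz_on (range p) (\<phi> i)"
      using lip[OF that] p(1) by (auto intro: lipschitz_on_subset)
    then show ?thesis unfolding \<psi>_def using lipschitz_on_compose[OF p(3)] by fastforce
  qed
  have "\<exists>W. - W \<in> null_sets lebesgue \<and>
    (\<forall>x. strict_mono_on {1..n - 1} x \<longrightarrow> x ` {1..n - 1} \<subseteq> W \<longrightarrow>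
       asymptotically_periodic UNIV (pc n \<psi> x) \<and>
       finite (periodic_orbits UNIV (pc n \<psi> x)) \<and> card (periodic_orbits UNIV (pc n \<psi> x)) \<le> n)"
    by (rule generic_pc_on_line[OF \<open>n \<ge> 2\<close> lip_psi lam0 lam1])
  then obtain W where
    W: "- W \<in> null_sets lebesgue" and
    gen: "\<And>x. strict_mono_on {1..n - 1} x \<Longrightarrow> x ` {1..n - 1} \<subseteq> W \<Longrightarrow>
       asymptotically_periodic UNIV (pc n \<psi> x) \<and>
       finite (periodic_orbits UNIV (pc n \<psi> x)) \<and> card (periodic_orbits UNIV (pc n \<psi> x)) \<le> n"
    by blast
  have "I - W \<inter> I \<in> null_sets lebesgue"
    by (rule null_sets_completion_subset[OF _ W]) blast
  then have "full_set I (W \<inter> I)" unfolding full_set_def by blast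
  moreover have "asymptotically_periodic I (pc n \<phi> x) \<and>
       finite (periodic_orbits I (pc n \<phi> x)) \<and> card (periodic_orbits I (pc n \<phi> x)) \<le> n"
    if x: "x \<in> Omega (n - 1) I \<inter> ({1..n - 1} \<rightarrow>\<^sub>E W \<inter> I)" for x
  proof -
    let ?f = "pc n \<phi> x" and ?g = "pc n \<psi> x"
    have mono: "strict_mono_on {1..n - 1} x" using x unfolding Omega_def by blast
    have xW: "x ` {1..n - 1} \<subseteq> W" using x by (auto simp: PiE_def Pi_def)
    have fI: "?f t \<in> I" if "t \<in> I" for t
      using pc_maps_to[OF assms(3), of x] x that by blast
    have fg: "?f t = ?g t" if "t \<in> I" for t
      unfolding pc_def \<psi>_def using p(2)[OF that] by simp
    have gI: "?g t \<in> I" for t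
    proof -
      obtain i where i: "i \<in> {1..n}" "i = 1 \<or> x (i - 1) \<le> t" "i = n \<or> t < x i"
        using pc_index_exists[OF \<open>n \<ge> 2\<close> mono] .
      have "\<phi> i (p t) \<in> I" using ifs(1)[OF i(1)] p(1)[of t] interior_subset by blast
      then show ?thesis using pc_eqI[OF \<open>n \<ge> 2\<close> mono i, of \<psi>] unfolding \<psi>_def by simp
    qed
    have iter: "(?f ^^ k) t = (?g ^^ k) t \<and> (?g ^^ k) t \<in> I" if "t \<in> I" for k t
      using that by (induction k) (auto simp: fg gI)
    have orb: "orbit ?f t = orbit ?g t" if "t \<in> I" for t
      unfolding orbit_def using iter[OF that] by simp
    have om: "omega_limit ?f t = omega_limit ?g t" if "t \<in> I" for t
      unfolding omega_limit_def using iter[OF that] by simp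
    have per: "t \<in> I" if t: "(?g ^^ k) t = t" "k \<ge> 1" for k t
      using gI[of "(?g ^^ (k - 1)) t"] t by (cases k) auto
    have "periodic_orbits I ?f = periodic_orbits UNIV ?g"
    proof
      show "periodic_orbits I ?f \<subseteq> periodic_orbits UNIV ?g"
      proof
        fix c assume "c \<in> periodic_orbits I ?f"
        then obtain t k where t: "c = orbit ?f t" "t \<in> I" "k \<ge> 1" "(?f ^^ k) t = t"
          unfolding periodic_orbits_def by blast
        then have "c = orbit ?g t" "(?g ^^ k) t = t" using orb[of t] iter[of t k] by auto
        with t(3) show "c \<in> periodic_orbits UNIV ?g" unfolding periodic_orbits_def by blast
      qed
      show "periodic_orbits UNIV ?g \<subseteq> periodic_orbits I ?f"
      proof
        fix c assume "c \<in> periodic_orbits UNIV ?g"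
        then obtain t k where t: "c = orbit ?g t" "k \<ge> 1" "(?g ^^ k) t = t"
          unfolding periodic_orbits_def by blast
        have tI: "t \<in> I" using per t by blast
        have "c = orbit ?f t" "(?f ^^ k) t = t" using t orb[OF tI] iter[OF tI, of k] by auto
        with t(2) tI show "c \<in> periodic_orbits I ?f" unfolding periodic_orbits_def by blast
      qed
    qed
    then show ?thesis
      using gen[OF mono xW] om unfolding asymptotically_periodic_def by simp
  qed
  ultimately show ?thesis by blast
qed

end
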